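(* Let $N$ be a marked Poisson cluster process (as described in the context) with cluster totals $D_i$ and residue $\varepsilon_t$, let $D$ be a random variable with the law of $D_1$, and let $\mu_D=\mathbb{E}D$. Suppose that $0<\mathbb{E}D^2<\infty$ and that $\varepsilon_t=o_P(\sqrt t)$, i.e. $\varepsilon_t/\sqrt t\to 0$ in probability as $t\to\infty$. Then, as $t\to\infty$, $$\frac{S(t)-t\,\nu\,\mu_D}{\sqrt{t\,\nu\,\mathbb{E}D^2}}\ \stackrel{d}{\longrightarrow}\ N(0,1).$$
   Context: Marked Poisson cluster model. Let $\mathbb{S}$ be a completely metrizable separable space with Borel $\sigma$-algebra $\mathcal S$, $Q$ a probability measure on $\mathbb{S}$, and $\nu>0$ a constant. Let $N^0=\sum_{i\ge1}\delta_{\Gamma_i,A_i}$ be a Poisson point process on $[0,\infty)\times\mathbb{S}$ with intensity $(\nu\,\mathrm{Leb})\times Q$, where $\Gamma_1\le\Gamma_2\le\cdots$. Let $M_p$ be the space of locally finite point measures on $[0,\infty)\times\mathbb{S}$. There is a probability kernel from $\mathbb{S}$ to $M_p$, denoted $\mathcal K$, such that, conditionally on $N^0$, point processes $G^{A_i}$, $i\ge1$, are independent, a.s. finite, with $G^{A_i}$ having law $\mathcal K(A_i,\cdot)$. Write $G^{A_i}=\sum_{j=1}^{K_i}\delta_{T_{ij},A_{ij}}$, where $K_i$ is $\mathbb{N}_0$-valued and $T_{ij}\ge0$; $K_i$ may depend on $A_i$, and it is assumed that $\mathbb{E}K_i<\infty$. Set $T_{i0}=0$, $A_{i0}=A_i$.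 The cluster process is $N=\sum_{i\ge1}\sum_{j=0}^{K_i}\delta_{\Gamma_i+T_{ij},A_{ij}}$. Let $f:\mathbb{S}\to[0,\infty)$ be measurable and $X_{ij}=f(A_{ij})$. Total claim amount: $S(t)=\int_{[0,t]\times\mathbb{S}}f(a)\,N(ds,da)$. Cluster totals: $D_i=\sum_{j=0}^{K_i}X_{ij}$ (i.i.d. in $i$). Residue at time $t\ge 0$: $\varepsilon_t=\sum_{i,j:\ 0\le\Gamma_i\le t<\Gamma_i+T_{ij}}X_{ij}$ (with $1\le j\le K_i$). *)

theory Defs
  imports "HOL-Probability.Probability"
begin

section \<open>Point measures on \<open>[0,\<infinity>) \<times> \<S>\<close>\<close>

text \<open>Since \<open>\<S>\<close> is second countable, this product \<open>\<sigma>\<close>-algebra is the Borel \<open>\<sigma>\<close>-algebra of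
  \<open>[0,\<infinity>) \<times> \<S>\<close>.\<close>

definition state_space :: "(real \<times> 'a::polish_space) measure" where
  "state_space = restrict_space borel {0..} \<Otimes>\<^sub>M borel"

text \<open>The sum of the Dirac masses at the points \<open>x i\<close>, \<open>i \<in> I\<close>, with multiplicities: the image of
  counting measure on \<open>I\<close> under \<open>x\<close>, which must map \<open>I\<close> into \<open>[0,\<infinity>) \<times> \<S>\<close>.\<close>

definition point_measure :: "'i set \<Rightarrow> ('i \<Rightarrow> real \<times> 'a::polish_space) \<Rightarrow> (real \<times> 'a) measure" where
  "point_measure I x = distr (count_space I) state_space x"

definition locally_finite :: "(real \<times> 'a::polish_space) measure \<Rightarrow> bool" where
  "locally_finite \<mu> \<longleftrightarrow>
     (\<forall>p\<in>space state_space. \<exists>U. open U \<and> p \<in> U \<and> emeasure \<mu> (U \<inter> space state_space) < \<infinity>)"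

definition point_measures :: "(real \<times> 'a::polish_space) measure set" where
  "point_measures =
     {\<mu>. locally_finite \<mu> \<and>
        (\<exists>(I::nat set) x. x \<in> I \<rightarrow> space state_space \<and> \<mu> = point_measure I x)}"

text \<open>\<open>M\<^sub>p\<close> carries the \<open>\<sigma>\<close>-algebra generated by the evaluations \<open>\<mu> \<mapsto> \<mu>(B)\<close>
  (compare \<^const>\<open>subprob_algebra\<close>).\<close>

definition point_measure_algebra :: "(real \<times> 'a::polish_space) measure measure" where
  "point_measure_algebra =
     (SUP B \<in> sets state_space. vimage_algebra point_measures (\<lambda>\<mu>. emeasure \<mu> B) borel)"

text \<open>The Poisson weights are written out because \<^const>\<open>poisson_pmf\<close> excludes rate \<open>0\<close>.\<close>

definition (in prob_space) poisson_point_process ::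
    "('a \<Rightarrow> (real \<times> 'b::polish_space) measure) \<Rightarrow> (real \<times> 'b) measure \<Rightarrow> bool" where
  "poisson_point_process N \<mu> \<longleftrightarrow>
     N \<in> M \<rightarrow>\<^sub>M point_measure_algebra \<and>
     (\<forall>B\<in>sets state_space. \<forall>k::nat.
        prob {\<omega>\<in>space M. emeasure (N \<omega>) B = of_nat k} =
          (if emeasure \<mu> B = \<infinity> then 0 else measure \<mu> B ^ k / fact k * exp (- measure \<mu> B))) \<and>
     (\<forall>n B. (\<forall>i<n. B i \<in> sets state_space) \<and> disjoint_family_on B {..<n::nat} \<longrightarrow>
        indep_vars (\<lambda>_. borel) (\<lambda>i \<omega>. emeasure (N \<omega>) (B i)) {..<n})"


section \<open>The marked Poisson cluster model\<close>

text \<open>Clusters are indexed by \<open>i \<ge> 1\<close>; \<open>j = 0\<close> is the immigrant of the cluster and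
  \<open>1 \<le> j \<le> K i\<close> are its offspring, so \<open>A i 0\<close> is the mark \<open>A\<^sub>i\<close>.\<close>

definition immigrant_process ::
    "(nat \<Rightarrow> 'w \<Rightarrow> real) \<Rightarrow> (nat \<Rightarrow> nat \<Rightarrow> 'w \<Rightarrow> 'a::polish_space) \<Rightarrow> 'w \<Rightarrow> (real \<times> 'a) measure" where
  "immigrant_process \<Gamma> A \<omega> = point_measure {1..} (\<lambda>i. (\<Gamma> i \<omega>, A i 0 \<omega>))"

definition offspring_process ::
    "(nat \<Rightarrow> 'w \<Rightarrow> nat) \<Rightarrow> (nat \<Rightarrow> nat \<Rightarrow> 'w \<Rightarrow> real) \<Rightarrow> (nat \<Rightarrow> nat \<Rightarrow> 'w \<Rightarrow> 'a::polish_space) \<Rightarrow>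
      nat \<Rightarrow> 'w \<Rightarrow> (real \<times> 'a) measure" where
  "offspring_process K T A i \<omega> = point_measure {1..K i \<omega>} (\<lambda>j. (T i j \<omega>, A i j \<omega>))"

definition cluster_process ::
    "(nat \<Rightarrow> 'w \<Rightarrow> real) \<Rightarrow> (nat \<Rightarrow> 'w \<Rightarrow> nat) \<Rightarrow> (nat \<Rightarrow> nat \<Rightarrow> 'w \<Rightarrow> real) \<Rightarrow>
      (nat \<Rightarrow> nat \<Rightarrow> 'w \<Rightarrow> 'a::polish_space) \<Rightarrow> 'w \<Rightarrow> (real \<times> 'a) measure" where
  "cluster_process \<Gamma> K T A \<omega> =
     point_measure (SIGMA i:{1..}. {0..K i \<omega>}) (\<lambda>(i, j). (\<Gamma> i \<omega> + T i j \<omega>, A i j \<omega>))"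

definition total_claim ::
    "('a::polish_space \<Rightarrow> real) \<Rightarrow> (nat \<Rightarrow> 'w \<Rightarrow> real) \<Rightarrow> (nat \<Rightarrow> 'w \<Rightarrow> nat) \<Rightarrow>
      (nat \<Rightarrow> nat \<Rightarrow> 'w \<Rightarrow> real) \<Rightarrow> (nat \<Rightarrow> nat \<Rightarrow> 'w \<Rightarrow> 'a) \<Rightarrow> real \<Rightarrow> 'w \<Rightarrow> real" where
  "total_claim f \<Gamma> K T A t \<omega> =
     (LINT p:{0..t} \<times> UNIV|cluster_process \<Gamma> K T A \<omega>. f (snd p))"

definition cluster_total ::
    "('a \<Rightarrow> real) \<Rightarrow> (nat \<Rightarrow> 'w \<Rightarrow> nat) \<Rightarrow> (nat \<Rightarrow> nat \<Rightarrow> 'w \<Rightarrow> 'a) \<Rightarrow> nat \<Rightarrow> 'w \<Rightarrow> real" where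
  "cluster_total f K A i \<omega> = (\<Sum>j=0..K i \<omega>. f (A i j \<omega>))"

definition residue_at ::
    "('a \<Rightarrow> real) \<Rightarrow> (nat \<Rightarrow> 'w \<Rightarrow> real) \<Rightarrow> (nat \<Rightarrow> 'w \<Rightarrow> nat) \<Rightarrow>
      (nat \<Rightarrow> nat \<Rightarrow> 'w \<Rightarrow> real) \<Rightarrow> (nat \<Rightarrow> nat \<Rightarrow> 'w \<Rightarrow> 'a) \<Rightarrow> real \<Rightarrow> 'w \<Rightarrow> real" where
  "residue_at f \<Gamma> K T A t \<omega> =
     (\<Sum>\<^sub>\<infinity>(i, j)\<in>{(i, j). 1 \<le> i \<and> 1 \<le> j \<and> j \<le> K i \<omega> \<and>
                        0 \<le> \<Gamma> i \<omega> \<and> \<Gamma> i \<omega> \<le> t \<and> t < \<Gamma> i \<omega> + T i j \<omega>}. f (A i j \<omega>))"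

text \<open>\<open>Q\<close> is the law of the marks, \<open>\<nu>\<close> the rate and \<open>\<kappa>\<close> the kernel of the offspring processes. The
  assumption \<open>cluster_law\<close> says that, given the immigrant process, the offspring processes are
  independent with laws \<open>\<kappa> (A i 0)\<close>.\<close>

locale marked_poisson_cluster = prob_space M
  for M :: "'w measure"
    and Q :: "'a::polish_space measure"
    and \<nu> :: real
    and \<kappa> :: "'a \<Rightarrow> (real \<times> 'a) measure measure"
    and \<Gamma> :: "nat \<Rightarrow> 'w \<Rightarrow> real"
    and K :: "nat \<Rightarrow> 'w \<Rightarrow> nat"
    and T :: "nat \<Rightarrow> nat \<Rightarrow> 'w \<Rightarrow> real"
    and A :: "nat \<Rightarrow> nat \<Rightarrow> 'w \<Rightarrow> 'a" +
  assumes Q_prob: "prob_space Q" and Q_sets: "sets Q = sets borel"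
    and rate_pos: "\<nu> > 0"
    and kernel: "\<kappa> \<in> borel \<rightarrow>\<^sub>M prob_algebra point_measure_algebra"
    and Gamma_measurable: "\<And>i. 1 \<le> i \<Longrightarrow> \<Gamma> i \<in> M \<rightarrow>\<^sub>M borel"
    and K_measurable: "\<And>i. 1 \<le> i \<Longrightarrow> K i \<in> M \<rightarrow>\<^sub>M count_space UNIV"
    and T_measurable: "\<And>i j. 1 \<le> i \<Longrightarrow> T i j \<in> M \<rightarrow>\<^sub>M borel"
    and A_measurable: "\<And>i j. 1 \<le> i \<Longrightarrow> A i j \<in> M \<rightarrow>\<^sub>M borel"
    and Gamma_nonneg: "\<And>i \<omega>. 1 \<le> i \<Longrightarrow> \<omega> \<in> space M \<Longrightarrow> 0 \<le> \<Gamma> i \<omega>"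
    and Gamma_mono: "\<And>i \<omega>. 1 \<le> i \<Longrightarrow> \<omega> \<in> space M \<Longrightarrow> \<Gamma> i \<omega> \<le> \<Gamma> (Suc i) \<omega>"
    and T_immigrant: "\<And>i \<omega>. 1 \<le> i \<Longrightarrow> \<omega> \<in> space M \<Longrightarrow> T i 0 \<omega> = 0"
    and T_nonneg: "\<And>i j \<omega>. 1 \<le> i \<Longrightarrow> \<omega> \<in> space M \<Longrightarrow> 1 \<le> j \<Longrightarrow> j \<le> K i \<omega> \<Longrightarrow> 0 \<le> T i j \<omega>"
    and immigrants:
      "poisson_point_process (immigrant_process \<Gamma> A)
         (density (restrict_space lborel {0..}) (\<lambda>_. ennreal \<nu>) \<Otimes>\<^sub>M Q)"
    and cluster_law:
      "\<And>J B. finite J \<Longrightarrow> J \<subseteq> {1..} \<Longrightarrow> (\<And>i. i \<in> J \<Longrightarrow> B i \<in> sets point_measure_algebra) \<Longrightarrow>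
         AE \<omega> in M.
           real_cond_exp M
             (vimage_algebra (space M) (immigrant_process \<Gamma> A) point_measure_algebra)
             (indicator {\<omega>'\<in>space M. \<forall>i\<in>J. offspring_process K T A i \<omega>' \<in> B i}) \<omega> =
           (\<Prod>i\<in>J. measure (\<kappa> (A i 0 \<omega>)) (B i))"
    and K_integrable: "\<And>i. 1 \<le> i \<Longrightarrow> integrable M (\<lambda>\<omega>. real (K i \<omega>))"


section \<open>Modes of convergence\<close>

definition (in prob_space) tendsto_in_prob ::
    "('t \<Rightarrow> 'a \<Rightarrow> real) \<Rightarrow> real \<Rightarrow> 't filter \<Rightarrow> bool" where
  "tendsto_in_prob X c F \<longleftrightarrow>
     (\<forall>\<delta>>0. ((\<lambda>t. prob {\<omega>\<in>space M. \<bar>X t \<omega> - c\<bar> > \<delta>}) \<longlongrightarrow> 0) F)"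

text \<open>\<^const>\<open>weak_conv_m\<close> is restricted to sequences; this is the same notion along a filter.\<close>

definition weak_conv_along :: "('t \<Rightarrow> real measure) \<Rightarrow> real measure \<Rightarrow> 't filter \<Rightarrow> bool" where
  "weak_conv_along P L F \<longleftrightarrow>
     (\<forall>x. isCont (cdf L) x \<longrightarrow> ((\<lambda>t. cdf (P t) x) \<longlongrightarrow> cdf L x) F)"

lemma weak_conv_m_eq_weak_conv_along: "weak_conv_m P L \<longleftrightarrow> weak_conv_along P L sequentially"
  by (simp add: weak_conv_m_def weak_conv_def weak_conv_along_def)

end

theory Submission
  imports Defs
begin

text \<open>A claim of a cluster that was started by time \<open>t\<close> either falls into \<open>[0, t]\<close> or is counted in the
residue, so almost surely
\<open>S(t) = (\<Sum>i \<le> \<tau>(t). D\<^sub>i) - \<epsilon>\<^sub>t\<close>, where \<open>\<tau>(t)\<close> is the number of immigrants up to time \<open>t\<close>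
(\<open>AE_total_claim_decomposition\<close>). The residue vanishes on the scale \<open>\<surd>t\<close>, and so the statement reduces to
the central limit theorem for a compound Poisson sum. Everything is done with characteristic functions,
to which Levy's continuity theorem is applied at the end.

The characteristic function of the compound sum is \<open>exp (\<nu> t (\<phi>\<^sub>D(u) - 1))\<close> (\<open>char_compound_sum\<close>). The
model does not present the \<open>D\<^sub>i\<close> as an i.i.d. sequence independent of \<open>\<tau>(t)\<close>: it only describes the
immigrants as a random measure, and the offspring processes conditionally on that measure. Deriving the
i.i.d. structure can be avoided. Given the immigrants, each offspring process is averaged out with its
own kernel (\<open>expectation_offspring\<close>), which leaves the product over the immigrants up to time \<open>t\<close> of
\<open>\<phi>(mark)\<close>, where \<open>\<phi>(a)\<close> is the characteristic function of a cluster total given the mark \<open>a\<close>. The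
expectation of such a product does not depend on how the immigrants are enumerated; it is the
generating functional \<open>exp (\<nu> t (\<integral>\<phi> dQ - 1))\<close> of the Poisson process (\<open>expectation_prod_marks\<close>).

The enumeration enters only in the identity \<open>\<integral>\<phi> dQ = \<phi>\<^sub>D\<close>, because the law of \<open>D\<close> is that of the
cluster of the first immigrant. It requires that the first mark has law \<open>Q\<close>, and that it is, up to null
events, a function of the random measure on which the cluster law is conditioned. Both follow by
approximating the event that the first mark lies in \<open>B\<close> from inside by events that are described in
terms of void sets of the Poisson process (\<open>first_mark_approximation\<close>, \<open>first_mark\<close>).

Finally \<open>\<phi>\<^sub>D(v) = 1 + i v \<mu>\<^sub>D - v\<^sup>2 E D\<^sup>2 / 2 + o(v\<^sup>2)\<close>. At \<open>v = u / \<surd>(t \<nu> E D\<^sup>2)\<close> the centring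
cancels the linear term, and \<open>\<nu> t\<close> times the quadratic term is exactly \<open>- u\<^sup>2 / 2\<close>. This explains why the
second moment of \<open>D\<close>, and not its variance, is the right normalisation: the Poisson fluctuation of the
number of clusters adds the missing \<open>\<mu>\<^sub>D\<^sup>2\<close>.
\<close>

section \<open>Expectations of functions into the unit disc\<close>

text \<open>Simple approximations are commonly dominated by a multiple of the limit only, which yields no common
bound for products with a random number of factors. Retracting the approximations onto the unit disc
keeps all such products in the unit disc, so that dominated convergence applies to them.\<close>

lemma unit_disc_simple_approximation:
  fixes h :: "'a \<Rightarrow> complex"
  assumes h: "h \<in> borel_measurable N" and bound: "\<And>x. x \<in> space N \<Longrightarrow> norm (h x) \<le> 1"
  obtains s where "\<And>n. simple_function N (s n)" "\<And>n x. norm (s n x :: complex) \<le> 1"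
    "\<And>x. x \<in> space N \<Longrightarrow> (\<lambda>n. s n x) \<longlonglongrightarrow> h x"
proof -
  obtain s where s: "\<And>n. simple_function N (s n)" "\<And>x. x \<in> space N \<Longrightarrow> (\<lambda>n. s n x) \<longlonglongrightarrow> h x"
    using borel_measurable_implies_sequence_metric[OF h, of 0] by blast
  let ?r = "\<lambda>z::complex. z / of_real (max 1 (norm z))"
  show thesis
  proof (rule that[of "\<lambda>n x. ?r (s n x)"])
    show "simple_function N (\<lambda>x. ?r (s n x))" for n
      by (rule simple_function_compose1[OF s(1)])
    show "norm (?r (s n x)) \<le> 1" for n x
      by (simp add: norm_divide max_def)
    fix x assume x: "x \<in> space N"
    have "(\<lambda>n. ?r (s n x)) \<longlonglongrightarrow> ?r (h x)"
      using s(2)[OF x] by (intro tendsto_intros) auto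
    then show "(\<lambda>n. ?r (s n x)) \<longlonglongrightarrow> h x"
      using bound[OF x] by (simp add: max_absorb1)
  qed
qed

lemma (in prob_space) integrable_unit_disc:
  fixes X :: "'a \<Rightarrow> complex"
  assumes "X \<in> borel_measurable M" "\<And>\<omega>. \<omega> \<in> space M \<Longrightarrow> norm (X \<omega>) \<le> 1"
  shows "integrable M X"
  using assms by (intro integrable_const_bound[of _ 1]) auto

lemma (in prob_space) expectation_tendsto_unit_disc:
  fixes X :: "nat \<Rightarrow> 'a \<Rightarrow> complex"
  assumes "\<And>n. X n \<in> borel_measurable M" "Y \<in> borel_measurable M"
    and "\<And>n \<omega>. \<omega> \<in> space M \<Longrightarrow> norm (X n \<omega>) \<le> 1"
    and "\<And>\<omega>. \<omega> \<in> space M \<Longrightarrow> (\<lambda>n. X n \<omega>) \<longlonglongrightarrow> Y \<omega>"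
  shows "(\<lambda>n. expectation (X n)) \<longlonglongrightarrow> expectation Y"
  using assms by (intro integral_dominated_convergence[where w = "\<lambda>_. 1"]) auto

lemma (in prob_space) norm_expectation_unit_disc:
  fixes X :: "'a \<Rightarrow> complex"
  assumes "X \<in> borel_measurable M" "\<And>\<omega>. \<omega> \<in> space M \<Longrightarrow> norm (X \<omega>) \<le> 1"
  shows "norm (expectation X) \<le> 1"
proof -
  have "norm (expectation X) \<le> expectation (\<lambda>\<omega>. norm (X \<omega>))"
    by (rule integral_norm_bound)
  also have "\<dots> \<le> expectation (\<lambda>_. 1)"
    using assms by (intro integral_mono integrable_norm integrable_unit_disc) auto
  finally show ?thesis
    by (simp add: prob_space)
qed

text \<open>Splits an expectation according to a random number \<open>\<tau>\<close> of factors or summands, so that each part can be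
treated with that number fixed.\<close>

lemma (in prob_space) expectation_sums_over_values:
  fixes X :: "'a \<Rightarrow> complex" and \<tau> :: "'a \<Rightarrow> nat"
  assumes X [measurable]: "X \<in> borel_measurable M" and bound: "\<And>\<omega>. \<omega> \<in> space M \<Longrightarrow> norm (X \<omega>) \<le> 1"
    and \<tau> [measurable]: "\<tau> \<in> M \<rightarrow>\<^sub>M count_space UNIV"
  shows "(\<lambda>n. expectation (\<lambda>\<omega>. if \<tau> \<omega> = n then X \<omega> else 0)) sums expectation X"
proof -
  have int: "integrable M (\<lambda>\<omega>. if \<tau> \<omega> = n then X \<omega> else 0)" for n
    using bound by (intro integrable_unit_disc) auto
  have split: "(\<Sum>k<n. if \<tau> \<omega> = k then X \<omega> else 0) = (if \<tau> \<omega> < n then X \<omega> else 0)" for n \<omega>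
    by simp
  have "(\<lambda>n. expectation (\<lambda>\<omega>. if \<tau> \<omega> < n then X \<omega> else 0)) \<longlonglongrightarrow> expectation X"
  proof (rule expectation_tendsto_unit_disc)
    show "(\<lambda>n. if \<tau> \<omega> < n then X \<omega> else 0) \<longlonglongrightarrow> X \<omega>" for \<omega>
      by (rule tendsto_eventually, rule eventually_sequentiallyI[of "Suc (\<tau> \<omega>)"]) auto
  qed (use bound in auto)
  moreover have "(\<Sum>k<n. expectation (\<lambda>\<omega>. if \<tau> \<omega> = k then X \<omega> else 0)) =
      expectation (\<lambda>\<omega>. if \<tau> \<omega> < n then X \<omega> else 0)" for n
    unfolding split[symmetric] using int by (intro Bochner_Integration.integral_sum[symmetric]) auto
  ultimately show ?thesis
    by (simp add: sums_def)
qed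

lemma (in prob_space) poisson_generating_function:
  fixes c :: complex and m :: real
  assumes \<tau> [measurable]: "\<tau> \<in> M \<rightarrow>\<^sub>M count_space UNIV"
    and pois: "\<And>k::nat. prob {\<omega>\<in>space M. \<tau> \<omega> = k} = m ^ k / fact k * exp (- m)"
    and c: "norm c \<le> 1"
  shows "expectation (\<lambda>\<omega>. c ^ \<tau> \<omega>) = exp (of_real m * (c - 1))"
proof -
  have meas: "(\<lambda>\<omega>. c ^ \<tau> \<omega>) \<in> borel_measurable M"
    by measurable
  have "expectation (\<lambda>\<omega>. if \<tau> \<omega> = k then c ^ \<tau> \<omega> else 0)
      = exp (- of_real m) * ((of_real m * c) ^ k /\<^sub>R fact k)" for k
  proof -
    have "expectation (\<lambda>\<omega>. if \<tau> \<omega> = k then c ^ \<tau> \<omega> else 0)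
        = expectation (\<lambda>\<omega>. of_real (indicator {\<omega>\<in>space M. \<tau> \<omega> = k} \<omega>) * c ^ k)"
      by (intro Bochner_Integration.integral_cong) auto
    also have "\<dots> = of_real (prob {\<omega>\<in>space M. \<tau> \<omega> = k}) * c ^ k"
      by (subst integral_mult_left_zero) (simp_all add: integral_complex_of_real)
    finally show ?thesis
      by (simp add: pois exp_of_real[symmetric] power_mult_distrib scaleR_conv_of_real field_simps)
  qed
  moreover have "(\<lambda>k. exp (- of_real m) * ((of_real m * c) ^ k /\<^sub>R fact k))
      sums (exp (- of_real m) * exp (of_real m * c))"
    by (intro sums_mult exp_converges)
  ultimately have "expectation (\<lambda>\<omega>. c ^ \<tau> \<omega>) = exp (- of_real m) * exp (of_real m * c)"
    using expectation_sums_over_values[OF meas _ \<tau>] c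
    by (simp add: norm_power power_le_one sums_iff)
  then show ?thesis
    by (simp add: exp_add[symmetric] algebra_simps)
qed

text \<open>Turns a product of simple functions into a linear combination of products of indicators: \<open>p i c\<close>
stands for the indicator, or the probability, of the \<open>i\<close>-th factor having the value \<open>c\<close>.\<close>

lemma prod_sum_expand:
  fixes p :: "'i \<Rightarrow> complex \<Rightarrow> complex"
  assumes "finite J" "finite C" "\<And>i. i \<in> J \<Longrightarrow> x i = (\<Sum>c\<in>C. c * p i c)"
  shows "(\<Prod>i\<in>J. x i) = (\<Sum>q\<in>J \<rightarrow>\<^sub>E C. (\<Prod>i\<in>J. q i) * (\<Prod>i\<in>J. p i (q i)))"
  using assms by (simp add: prod_sum_PiE prod.distrib)

section \<open>Characteristic functions\<close>

text \<open>The remainder is at most \<open>v\<^sup>2 / 6\<close> times the expectation of \<open>min (6 x\<^sup>2) (\<bar>v\<bar> \<bar>x\<bar>\<^sup>3)\<close>, and that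
expectation tends to \<open>0\<close> by dominated convergence with dominating function \<open>6 x\<^sup>2\<close>.\<close>

lemma (in real_distribution) char_second_order_expansion:
  assumes int2: "integrable M (\<lambda>x. x\<^sup>2)"
  shows "((\<lambda>v. (char M v - 1 - \<i> * of_real (v * expectation (\<lambda>x. x))) / of_real (v\<^sup>2))
           \<longlongrightarrow> of_real (- (expectation (\<lambda>x. x\<^sup>2) / 2))) (at 0)"
    (is "(?q \<longlongrightarrow> ?l) _")
proof -
  have int1: "integrable M (\<lambda>x. x)"
    by (rule square_integrable_imp_integrable[OF _ int2]) simp
  define r where "r v = expectation (\<lambda>x. min (2 * \<bar>x\<bar>^2 * Suc 2) (\<bar>v\<bar> * \<bar>x\<bar>^Suc 2))" for v :: real
  have r: "(r \<longlongrightarrow> 0) (at 0)"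
    unfolding tendsto_at_iff_sequentially comp_def
  proof (intro allI impI)
    fix X :: "nat \<Rightarrow> real" assume X: "X \<longlonglongrightarrow> 0"
    have "(\<lambda>i. r (X i)) \<longlonglongrightarrow> expectation (\<lambda>x. 0)"
      unfolding r_def
    proof (rule integral_dominated_convergence[where w = "\<lambda>x. 6 * x\<^sup>2"])
      show "AE x in M. (\<lambda>i. min (2 * \<bar>x\<bar>^2 * Suc 2) (\<bar>X i\<bar> * \<bar>x\<bar>^Suc 2)) \<longlonglongrightarrow> 0"
      proof (rule AE_I2)
        fix x :: real
        have "(\<lambda>i. min (2 * \<bar>x\<bar>^2 * Suc 2) (\<bar>X i\<bar> * \<bar>x\<bar>^Suc 2))
            \<longlonglongrightarrow> min (2 * \<bar>x\<bar>^2 * Suc 2) (\<bar>0\<bar> * \<bar>x\<bar>^Suc 2)"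
          by (intro tendsto_intros X)
        then show "(\<lambda>i. min (2 * \<bar>x\<bar>^2 * Suc 2) (\<bar>X i\<bar> * \<bar>x\<bar>^Suc 2)) \<longlonglongrightarrow> 0"
          by simp
      qed
    qed (use int2 in auto)
    then show "(\<lambda>i. r (X i)) \<longlonglongrightarrow> 0"
      by simp
  qed
  have bound: "norm (?q v - ?l) \<le> r v / 6" if "v \<noteq> 0" for v
  proof -
    have mom: "integrable M (\<lambda>x. x ^ k)" if "k \<le> 2" for k
      using that int1 int2 by (auto simp: le_Suc_eq numeral_2_eq_2)
    have eq: "?q v - ?l = (char M v - (\<Sum>k\<le>2. ((\<i> * v)^k / fact k) * expectation (\<lambda>x. x^k))) / of_real (v\<^sup>2)"
      using that prob_space by (simp add: numeral_2_eq_2 power_mult_distrib field_simps)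
    have "norm (?q v - ?l) \<le> ((\<bar>v\<bar>^2 / fact (Suc 2)) * r v) / v\<^sup>2"
      unfolding eq norm_divide norm_of_real r_def
      using char_approx2[OF mom, of 2 v] by (intro divide_mono) (use that in auto)
    then show ?thesis
      using that by (simp add: fact_numeral field_simps)
  qed
  have "((\<lambda>v. ?q v - ?l) \<longlongrightarrow> 0) (at 0)"
  proof (rule Lim_null_comparison)
    show "\<forall>\<^sub>F v in at 0. norm (?q v - ?l) \<le> r v / 6"
      using bound by (auto simp: eventually_at_filter)
    show "((\<lambda>v. r v / 6) \<longlongrightarrow> 0) (at 0)"
      using tendsto_divide[OF r tendsto_const, of 6] by simp
  qed
  then show ?thesis
    by (rule LIM_zero_cancel)
qed

text \<open>The exponents combine to \<open>\<nu> t (\<phi>(v) - 1 - i v E x)\<close>, where \<open>\<nu> t v\<^sup>2 = u\<^sup>2 / E x\<^sup>2\<close> does not depend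
on \<open>t\<close>; the second-order expansion of \<open>\<phi>\<close> at \<open>0\<close> does the rest.\<close>

lemma (in real_distribution) compound_poisson_char_tendsto:
  fixes u \<nu> :: real
  assumes int2: "integrable M (\<lambda>x. x\<^sup>2)" and pos: "0 < expectation (\<lambda>x. x\<^sup>2)" and \<nu>: "0 < \<nu>"
  defines "v \<equiv> \<lambda>t. u / sqrt (t * \<nu> * expectation (\<lambda>x. x\<^sup>2))"
  shows "((\<lambda>t. iexp (- v t * (t * \<nu> * expectation (\<lambda>x. x))) * exp (of_real (\<nu> * t) * (char M (v t) - 1)))
           \<longlongrightarrow> of_real (exp (- u\<^sup>2 / 2))) at_top"
proof (cases "u = 0")
  case True
  then show ?thesis by (simp add: v_def char_zero)
next
  case False
  define q where "q v = (char M v - 1 - \<i> * of_real (v * expectation (\<lambda>x. x))) / of_real (v\<^sup>2)" for v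
  let ?s = "expectation (\<lambda>x. x\<^sup>2)"
  have v0: "v t \<noteq> 0" and v2: "\<nu> * t * (v t)\<^sup>2 = u\<^sup>2 / ?s" if "0 < t" for t
    using that pos \<nu> False by (simp_all add: v_def power_divide)
  have "filterlim v (at 0) at_top"
    unfolding filterlim_at
  proof
    show "(v \<longlongrightarrow> 0) at_top"
      unfolding v_def
      by (intro tendsto_divide_0[OF tendsto_const] filterlim_at_top_imp_at_infinity
          filterlim_compose[OF sqrt_at_top] filterlim_at_top_mult_tendsto_pos[OF tendsto_const]
          filterlim_ident pos \<nu>)
    show "\<forall>\<^sub>F t in at_top. v t \<in> UNIV \<and> v t \<noteq> 0"
      using eventually_gt_at_top[of 0] by eventually_elim (use v0 in auto)
  qed
  then have "((\<lambda>t. q (v t)) \<longlongrightarrow> of_real (- (?s / 2))) at_top"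
    using char_second_order_expansion[OF int2] unfolding q_def by (rule filterlim_compose[rotated])
  then have "((\<lambda>t. exp (of_real (u\<^sup>2 / ?s) * q (v t))) \<longlongrightarrow> exp (of_real (u\<^sup>2 / ?s) * of_real (- (?s / 2)))) at_top"
    by (intro tendsto_intros)
  also have "of_real (u\<^sup>2 / ?s) * of_real (- (?s / 2)) = (of_real (- u\<^sup>2 / 2) :: complex)"
    unfolding of_real_mult[symmetric] using pos by simp
  also have "exp (of_real (- u\<^sup>2 / 2)) = (of_real (exp (- u\<^sup>2 / 2)) :: complex)"
    by (rule exp_of_real)
  finally show ?thesis
  proof (rule Lim_transform_eventually)
    show "\<forall>\<^sub>F t in at_top. exp (of_real (u\<^sup>2 / ?s) * q (v t)) =
        iexp (- v t * (t * \<nu> * expectation (\<lambda>x. x))) * exp (of_real (\<nu> * t) * (char M (v t) - 1))"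
      using eventually_gt_at_top[of 0]
    proof eventually_elim
      case (elim t)
      have "of_real (u\<^sup>2 / ?s) * q (v t) = of_real (\<nu> * t) * (of_real ((v t)\<^sup>2) * q (v t))"
        unfolding v2[OF elim, symmetric] by simp
      also have "of_real ((v t)\<^sup>2) * q (v t) = char M (v t) - 1 - \<i> * of_real (v t * expectation (\<lambda>x. x))"
        using v0[OF elim] by (simp add: q_def)
      finally have eq: "of_real (u\<^sup>2 / ?s) * q (v t) =
          of_real (\<nu> * t) * (char M (v t) - 1 - \<i> * of_real (v t * expectation (\<lambda>x. x)))" .
      show ?case
        unfolding eq exp_add[symmetric] by (rule arg_cong[where f = exp]) (simp add: algebra_simps)
    qed
  qed
qed

text \<open>Slutsky's lemma for characteristic functions: where \<open>\<bar>R\<bar> \<le> \<delta>\<close> the two phases differ by at most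
\<open>\<bar>u\<bar> \<delta>\<close>, and elsewhere by at most \<open>2\<close>.\<close>

lemma (in prob_space) expectation_iexp_perturbation:
  fixes Z R :: "'a \<Rightarrow> real"
  assumes Z [measurable]: "Z \<in> borel_measurable M" and R [measurable]: "R \<in> borel_measurable M" and "0 < \<delta>"
  shows "norm (expectation (\<lambda>\<omega>. iexp (u * (Z \<omega> - R \<omega>))) - expectation (\<lambda>\<omega>. iexp (u * Z \<omega>)))
    \<le> \<bar>u\<bar> * \<delta> + 2 * prob {\<omega>\<in>space M. \<bar>R \<omega>\<bar> > \<delta>}"
proof -
  let ?B = "{\<omega>\<in>space M. \<bar>R \<omega>\<bar> > \<delta>}"
  have i1: "integrable M (\<lambda>\<omega>. iexp (u * (Z \<omega> - R \<omega>)))" "integrable M (\<lambda>\<omega>. iexp (u * Z \<omega>))"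
    by (intro integrable_unit_disc; simp)+
  have pw: "norm (iexp (u * (Z \<omega> - R \<omega>)) - iexp (u * Z \<omega>)) \<le> \<bar>u\<bar> * \<delta> + 2 * indicator ?B \<omega>"
    if "\<omega> \<in> space M" for \<omega>
  proof -
    have eq: "iexp (u * (Z \<omega> - R \<omega>)) - iexp (u * Z \<omega>) = iexp (u * Z \<omega>) * (iexp (- u * R \<omega>) - 1)"
      by (simp add: algebra_simps flip: exp_add)
    have n: "norm (iexp (u * (Z \<omega> - R \<omega>)) - iexp (u * Z \<omega>)) = norm (iexp (- u * R \<omega>) - 1)"
      unfolding eq norm_mult by simp
    show ?thesis
    proof (cases "\<omega> \<in> ?B")
      case True
      have "norm (iexp (- u * R \<omega>) - 1) \<le> norm (iexp (- u * R \<omega>)) + norm (1::complex)"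
        by (rule norm_triangle_ineq4)
      also have "\<dots> = 2"
        by (simp only: norm_exp_i_times norm_one)
      finally show ?thesis
        unfolding n using True \<open>0 < \<delta>\<close> by (simp add: add_nonneg_nonneg order_trans)
    next
      case False
      have "norm (iexp (- u * R \<omega>) - 1) \<le> \<bar>- u * R \<omega>\<bar>"
        using iexp_approx1[of "- u * R \<omega>" 0] by simp
      also have "\<dots> \<le> \<bar>u\<bar> * \<delta>"
        using False that by (auto simp: abs_mult intro!: mult_left_mono)
      finally show ?thesis
        unfolding n using False that by simp
    qed
  qed
  have "norm (expectation (\<lambda>\<omega>. iexp (u * (Z \<omega> - R \<omega>))) - expectation (\<lambda>\<omega>. iexp (u * Z \<omega>)))
      = norm (expectation (\<lambda>\<omega>. iexp (u * (Z \<omega> - R \<omega>)) - iexp (u * Z \<omega>)))"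
    using i1 by (subst Bochner_Integration.integral_diff) auto
  also have "\<dots> \<le> expectation (\<lambda>\<omega>. norm (iexp (u * (Z \<omega> - R \<omega>)) - iexp (u * Z \<omega>)))"
    by (rule integral_norm_bound)
  also have "\<dots> \<le> expectation (\<lambda>\<omega>. \<bar>u\<bar> * \<delta> + 2 * indicator ?B \<omega>)"
    using pw by (intro integral_mono integrable_norm Bochner_Integration.integrable_diff i1
        Bochner_Integration.integrable_add integrable_mult_right integrable_real_indicator) (auto simp: less_top[symmetric])
  also have "\<dots> = \<bar>u\<bar> * \<delta> + 2 * prob ?B"
  proof -
    have "integrable M (\<lambda>\<omega>. 2 * indicator ?B \<omega> :: real)"
      by (intro integrable_mult_right integrable_real_indicator) (auto simp: less_top[symmetric])
    then show ?thesis
      by (subst Bochner_Integration.integral_add) (simp_all add: prob_space)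
  qed
  finally show ?thesis .
qed

text \<open>Convergence at infinity along the reals can be tested on sequences, for which Levy's theorem holds.\<close>

lemma weak_conv_alongI_char:
  fixes \<mu> :: "real \<Rightarrow> real measure"
  assumes \<mu>: "\<And>t. real_distribution (\<mu> t)" and L: "real_distribution L"
    and char: "\<And>u. ((\<lambda>t. char (\<mu> t) u) \<longlongrightarrow> char L u) at_top"
  shows "weak_conv_along \<mu> L at_top"
  unfolding weak_conv_along_def
proof (intro allI impI tendsto_at_topI_sequentially)
  fix x and t :: "nat \<Rightarrow> real"
  assume x: "isCont (cdf L) x" and t: "filterlim t at_top sequentially"
  have "weak_conv_m (\<lambda>n. \<mu> (t n)) L"
    by (rule levy_continuity[OF \<mu> L]) (rule filterlim_compose[OF char t])
  then show "(\<lambda>n. cdf (\<mu> (t n)) x) \<longlonglongrightarrow> cdf L x"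
    using x by (simp add: weak_conv_m_def weak_conv_def)
qed

section \<open>Point measures\<close>

lemma space_state_space: "space state_space = {0..} \<times> UNIV"
  by (simp add: state_space_def space_pair_measure space_restrict_space)

lemma Times_in_sets_state_space:
  assumes "I \<in> sets borel" "I \<subseteq> {0..}" "B \<in> sets borel"
  shows "I \<times> B \<in> sets state_space"
  unfolding state_space_def using assms by (intro pair_measureI) (auto simp: sets_restrict_space_iff)

lemma snd_measurable_state_space: "f \<in> borel_measurable borel \<Longrightarrow> (\<lambda>p. f (snd p)) \<in> borel_measurable state_space"
  unfolding state_space_def by (rule measurable_compose[OF measurable_snd])

lemma Pair_measurable_state_space:
  assumes "X \<in> borel_measurable M" "Y \<in> borel_measurable M" "\<And>\<omega>. \<omega> \<in> space M \<Longrightarrow> 0 \<le> X \<omega>"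
  shows "(\<lambda>\<omega>. (X \<omega>, Y \<omega>)) \<in> M \<rightarrow>\<^sub>M state_space"
  unfolding state_space_def using assms
  by (intro measurable_Pair measurable_restrict_space2) auto

lemma sets_point_measure: "sets (point_measure I x) = sets state_space"
  by (simp add: point_measure_def)

lemma sets_point_measures: "\<mu> \<in> point_measures \<Longrightarrow> sets \<mu> = sets state_space"
  by (auto simp: point_measures_def sets_point_measure)

lemma space_point_measures: "\<mu> \<in> point_measures \<Longrightarrow> space \<mu> = space state_space"
  by (rule sets_eq_imp_space_eq[OF sets_point_measures])

lemma nn_integral_point_measure:
  assumes "x \<in> I \<rightarrow> space state_space" "F \<in> borel_measurable state_space"
  shows "(\<integral>\<^sup>+p. F p \<partial>point_measure I x) = (\<integral>\<^sup>+i. F (x i) \<partial>count_space I)"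
  unfolding point_measure_def using assms by (intro nn_integral_distr) auto

lemma emeasure_point_measure:
  assumes "x \<in> I \<rightarrow> space state_space" "B \<in> sets state_space"
  shows "emeasure (point_measure I x) B = emeasure (count_space I) {i\<in>I. x i \<in> B}"
  unfolding point_measure_def using assms
  by (subst emeasure_distr) (auto intro!: arg_cong[where f = "emeasure _"])

lemma space_point_measure_algebra: "space point_measure_algebra = point_measures"
  using sets.top[of state_space] by (force simp: point_measure_algebra_def space_Sup_eq_UN)

lemma measurable_emeasure_point_measure_algebra [measurable]:
  "B \<in> sets state_space \<Longrightarrow> (\<lambda>\<mu>. emeasure \<mu> B) \<in> borel_measurable point_measure_algebra"
  by (auto intro!: measurable_Sup1 measurable_vimage_algebra1 simp: point_measure_algebra_def)

lemma measurable_point_measure_algebraI: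
  assumes "\<And>\<omega>. \<omega> \<in> space M \<Longrightarrow> X \<omega> \<in> point_measures"
    and "\<And>B. B \<in> sets state_space \<Longrightarrow> (\<lambda>\<omega>. emeasure (X \<omega>) B) \<in> borel_measurable M"
  shows "X \<in> M \<rightarrow>\<^sub>M point_measure_algebra"
  using assms by (auto intro!: measurable_Sup2 measurable_vimage_algebra2 simp: point_measure_algebra_def)

text \<open>By induction on \<open>F\<close>: for indicators these are the evaluations that generate the \<open>\<sigma>\<close>-algebra, and
sums, multiples and monotone limits are preserved.\<close>

lemma nn_integral_measurable_point_measure_algebra:
  assumes "F \<in> borel_measurable state_space"
  shows "(\<lambda>\<mu>. integral\<^sup>N \<mu> F) \<in> borel_measurable point_measure_algebra" (is "_ \<in> ?B")
  using assms
proof induct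
  case (cong f g)
  moreover have "(\<lambda>\<mu>. \<integral>\<^sup>+p. f p \<partial>\<mu>) \<in> ?B \<longleftrightarrow> (\<lambda>\<mu>. \<integral>\<^sup>+p. g p \<partial>\<mu>) \<in> ?B"
    by (intro measurable_cong nn_integral_cong cong)
      (simp add: space_point_measure_algebra space_point_measures)
  ultimately show ?case by simp
next
  case (set B)
  then have "(\<lambda>\<mu>. \<integral>\<^sup>+p. indicator B p \<partial>\<mu>) \<in> ?B \<longleftrightarrow> (\<lambda>\<mu>. emeasure \<mu> B) \<in> ?B"
    by (intro measurable_cong nn_integral_indicator) (simp add: space_point_measure_algebra sets_point_measures)
  with set show ?case by simp
next
  case (mult f c)
  then have "(\<lambda>\<mu>. \<integral>\<^sup>+p. c * f p \<partial>\<mu>) \<in> ?B \<longleftrightarrow> (\<lambda>\<mu>. c * \<integral>\<^sup>+p. f p \<partial>\<mu>) \<in> ?B"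
    by (intro measurable_cong nn_integral_cmult)
      (simp add: space_point_measure_algebra sets_point_measures cong: measurable_cong_sets)
  with mult show ?case by simp
next
  case (add f g)
  then have "(\<lambda>\<mu>. \<integral>\<^sup>+p. f p + g p \<partial>\<mu>) \<in> ?B \<longleftrightarrow> (\<lambda>\<mu>. (\<integral>\<^sup>+p. f p \<partial>\<mu>) + (\<integral>\<^sup>+p. g p \<partial>\<mu>)) \<in> ?B"
    by (intro measurable_cong nn_integral_add)
      (simp_all add: space_point_measure_algebra sets_point_measures cong: measurable_cong_sets)
  with add show ?case by (simp add: ac_simps)
next
  case (seq F)
  then have "(\<lambda>\<mu>. \<integral>\<^sup>+p. (SUP i. F i) p \<partial>\<mu>) \<in> ?B \<longleftrightarrow> (\<lambda>\<mu>. SUP i. (\<integral>\<^sup>+p. F i p \<partial>\<mu>)) \<in> ?B"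
    unfolding SUP_apply
    by (intro measurable_cong nn_integral_monotone_convergence_SUP)
      (simp_all add: space_point_measure_algebra sets_point_measures cong: measurable_cong_sets)
  with seq show ?case by (simp add: ac_simps)
qed

lemma point_measure_in_point_measures:
  fixes I :: "nat set"
  assumes "finite I" "x \<in> I \<rightarrow> space state_space"
  shows "point_measure I x \<in> point_measures"
proof -
  have "emeasure (point_measure I x) B < \<infinity>" for B
  proof -
    have "emeasure (point_measure I x) B \<le> emeasure (point_measure I x) (space (point_measure I x))"
      by (rule emeasure_space)
    also have "\<dots> = emeasure (count_space I) {i\<in>I. x i \<in> space state_space}"
      using assms by (subst emeasure_point_measure) (auto simp: point_measure_def)
    also have "\<dots> < \<infinity>"
      using assms(1) by (subst emeasure_count_space_finite) (auto simp: of_nat_less_top)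
    finally show ?thesis .
  qed
  then have "locally_finite (point_measure I x)"
    unfolding locally_finite_def using open_UNIV by blast
  then show ?thesis
    using assms(2) by (auto simp: point_measures_def)
qed

text \<open>A natural number, so that it can serve as an exponent and as a number of factors. Infinitely many points
count as \<open>0\<close>; this happens on null events only.\<close>

definition point_count :: "(real \<times> 'a::polish_space) measure \<Rightarrow> (real \<times> 'a) set \<Rightarrow> nat" where
  "point_count \<mu> B = nat \<lfloor>measure \<mu> B\<rfloor>"

lemma measurable_point_count:
  "B \<in> sets state_space \<Longrightarrow> (\<lambda>\<mu>. point_count \<mu> B) \<in> point_measure_algebra \<rightarrow>\<^sub>M count_space UNIV"
  unfolding point_count_def measure_def by measurable

lemma point_count_point_measure:
  assumes "x \<in> I \<rightarrow> space state_space" "B \<in> sets state_space"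
  shows "point_count (point_measure I x) B = card {i\<in>I. x i \<in> B}"
proof (cases "finite {i\<in>I. x i \<in> B}")
  case True
  then show ?thesis
    using assms by (simp add: point_count_def measure_def emeasure_point_measure emeasure_count_space_finite)
next
  case False
  then show ?thesis
    using assms by (simp add: point_count_def measure_def emeasure_point_measure emeasure_count_space_infinite)
qed

section \<open>Sums over countable index sets\<close>

text \<open>Random sums over a random index set become measurable by summing over all indices and letting the
summand vanish off the random set.\<close>

lemma borel_measurable_nn_integral_count_space:
  fixes h :: "'i::countable \<Rightarrow> 'w \<Rightarrow> ennreal"
  assumes [measurable]: "\<And>i. h i \<in> borel_measurable M"
  shows "(\<lambda>\<omega>. \<integral>\<^sup>+i. h i \<omega> \<partial>count_space UNIV) \<in> borel_measurable M"
proof -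
  interpret sigma_finite_measure "count_space (UNIV :: 'i set)"
    by (rule sigma_finite_measure_count_space)
  have "(\<lambda>p. h (snd p) (fst p)) \<in> borel_measurable (M \<Otimes>\<^sub>M count_space UNIV)"
    by (rule measurable_compose_countable'[where f = "\<lambda>i p. h i (fst p)" and g = snd and I = UNIV]) auto
  then have "(\<lambda>(\<omega>, i). h i \<omega>) \<in> borel_measurable (M \<Otimes>\<^sub>M count_space UNIV)"
    by (simp add: split_def)
  then show ?thesis
    by (rule borel_measurable_nn_integral)
qed

text \<open>Also true for divergent sums: \<open>infsum\<close> is then \<open>0\<close> by default, as is \<open>enn2real \<infinity>\<close>.\<close>

lemma infsum_eq_enn2real_nn_integral:
  fixes h :: "'i \<Rightarrow> real"
  assumes "\<And>i. i \<in> I \<Longrightarrow> 0 \<le> h i"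
  shows "(\<Sum>\<^sub>\<infinity>i\<in>I. h i) = enn2real (\<integral>\<^sup>+i. ennreal (h i) \<partial>count_space I)"
proof -
  have "(\<Sum>\<^sub>\<infinity>i\<in>I. h i) = (LINT i|count_space I. h i)"
  proof (cases "Infinite_Set_Sum.abs_summable_on h I")
    case True
    then show ?thesis
      using infsetsum_infsum[of h I] abs_summable_equivalent[of h I] by (simp add: infsetsum_def)
  next
    case False
    have "\<not> h summable_on I"
    proof
      assume "h summable_on I"
      then have "(\<lambda>i. norm (h i)) summable_on I"
        using assms by (simp cong: summable_on_cong)
      then show False
        using False abs_summable_equivalent[of h I] by simp
    qed
    moreover have "\<not> integrable (count_space I) h"
      using False abs_summable_equivalent[of h I] by (simp add: Infinite_Set_Sum.abs_summable_on_def)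
    ultimately show ?thesis
      by (simp add: infsum_not_exists not_integrable_integral_eq)
  qed
  also have "\<dots> = enn2real (\<integral>\<^sup>+i. ennreal (h i) \<partial>count_space I)"
    using assms by (intro integral_eq_nn_integral) (auto simp: AE_count_space)
  finally show ?thesis .
qed

lemma nn_integral_count_space_if:
  "(\<integral>\<^sup>+x. F x \<partial>count_space S) = (\<integral>\<^sup>+x. (if x \<in> S then F x else 0) \<partial>count_space UNIV)"
proof -
  have "(\<integral>\<^sup>+x. F x \<partial>count_space S) = (\<integral>\<^sup>+x. (if x \<in> S then F x else 0) \<partial>count_space S)"
    by (rule nn_integral_cong) simp
  also have "\<dots> = (\<integral>\<^sup>+x. (if x \<in> S then F x else 0) \<partial>count_space UNIV)"
    by (rule nn_integral_count_space_eq) auto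
  finally show ?thesis .
qed

lemma enn2real_nn_integral_finite:
  assumes "finite S" "\<And>x. P x \<Longrightarrow> x \<in> S" "\<And>x. 0 \<le> F x"
  shows "enn2real (\<integral>\<^sup>+x. (if P x then ennreal (F x) else 0) \<partial>count_space UNIV) = (\<Sum>x\<in>S. if P x then F x else 0)"
proof -
  have "(\<integral>\<^sup>+x. (if P x then ennreal (F x) else 0) \<partial>count_space UNIV) = (\<Sum>x\<in>S. if P x then ennreal (F x) else 0)"
    using assms by (intro nn_integral_count_space') auto
  also have "\<dots> = (\<Sum>x\<in>S. ennreal (if P x then F x else 0))"
    by (intro sum.cong) auto
  also have "\<dots> = ennreal (\<Sum>x\<in>S. if P x then F x else 0)"
    using assms(3) by (intro sum_ennreal) auto
  finally show ?thesis
    using assms(3) by (simp add: sum_nonneg)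
qed

context marked_poisson_cluster
begin

section \<open>The immigrant process\<close>

abbreviation immigrant_intensity :: "(real \<times> 'a) measure" where
  "immigrant_intensity \<equiv> density (restrict_space lborel {0..}) (\<lambda>_. ennreal \<nu>) \<Otimes>\<^sub>M Q"

abbreviation immigrant_algebra :: "'w measure" where
  "immigrant_algebra \<equiv> vimage_algebra (space M) (immigrant_process \<Gamma> A) point_measure_algebra"

text \<open>Defined from the immigrant process as a random measure, so that it is measurable with respect to the
\<open>\<sigma>\<close>-algebra on which the cluster law is conditioned.\<close>

definition arrival_number :: "real \<Rightarrow> 'w \<Rightarrow> nat" where
  "arrival_number t \<omega> = point_count (immigrant_process \<Gamma> A \<omega>) ({0..t} \<times> UNIV)"

lemma immigrant_process_measurable [measurable]:
  "immigrant_process \<Gamma> A \<in> M \<rightarrow>\<^sub>M point_measure_algebra"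
  using immigrants unfolding poisson_point_process_def by simp

lemma measurable_immigrant_algebraI:
  "h \<in> point_measure_algebra \<rightarrow>\<^sub>M N \<Longrightarrow> (\<lambda>\<omega>. h (immigrant_process \<Gamma> A \<omega>)) \<in> immigrant_algebra \<rightarrow>\<^sub>M N"
  by (rule measurable_compose[OF measurable_vimage_algebra1])
    (use measurable_space[OF immigrant_process_measurable] in auto)

lemma immigrant_subalgebra: "subalgebra M immigrant_algebra"
  unfolding subalgebra_def
  using measurable_space[OF immigrant_process_measurable] immigrant_process_measurable
  by (auto simp: sets_vimage_algebra2)

lemma immigrant_points:
  "\<omega> \<in> space M \<Longrightarrow> (\<lambda>i. (\<Gamma> i \<omega>, A i 0 \<omega>)) \<in> {1..} \<rightarrow> space state_space"
  by (auto simp: space_state_space Gamma_nonneg)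

lemma emeasure_immigrant_process:
  assumes "\<omega> \<in> space M" "B \<in> sets state_space"
  shows "emeasure (immigrant_process \<Gamma> A \<omega>) B = emeasure (count_space {1..}) {i\<in>{1..}. (\<Gamma> i \<omega>, A i 0 \<omega>) \<in> B}"
  unfolding immigrant_process_def by (rule emeasure_point_measure[OF immigrant_points]) (use assms in auto)

lemma point_count_immigrant_process:
  assumes "\<omega> \<in> space M" "B \<in> sets state_space"
  shows "point_count (immigrant_process \<Gamma> A \<omega>) B = card {i\<in>{1..}. (\<Gamma> i \<omega>, A i 0 \<omega>) \<in> B}"
  unfolding immigrant_process_def by (rule point_count_point_measure[OF immigrant_points]) (use assms in auto)

lemma emeasure_immigrant_intensity:
  assumes I: "I \<in> sets borel" "I \<subseteq> {0..}" and l: "emeasure lborel I = ennreal l" "0 \<le> l" and B: "B \<in> sets borel"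
  shows "emeasure immigrant_intensity (I \<times> B) = ennreal (\<nu> * l * measure Q B)"
proof -
  interpret Q: prob_space Q by (rule Q_prob)
  have I': "I \<in> sets (restrict_space lborel {0..})"
    using I by (simp add: sets_restrict_space_iff)
  have "emeasure immigrant_intensity (I \<times> B) =
      emeasure (density (restrict_space lborel {0..}) (\<lambda>_. ennreal \<nu>)) I * emeasure Q B"
    by (rule Q.emeasure_pair_measure_Times) (use I' B Q_sets in auto)
  also have "emeasure (density (restrict_space lborel {0..}) (\<lambda>_. ennreal \<nu>)) I = ennreal (\<nu> * l)"
    using I I' l rate_pos by (simp add: emeasure_density_const emeasure_restrict_space ennreal_mult)
  finally show ?thesis
    using rate_pos l by (simp add: Q.emeasure_eq_measure ennreal_mult)
qed

lemma prob_immigrant_emeasure: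
  assumes "B \<in> sets state_space" "emeasure immigrant_intensity B \<noteq> \<infinity>"
  shows "prob {\<omega>\<in>space M. emeasure (immigrant_process \<Gamma> A \<omega>) B = of_nat k} =
    measure immigrant_intensity B ^ k / fact k * exp (- measure immigrant_intensity B)"
  using immigrants assms unfolding poisson_point_process_def by simp

text \<open>The Poisson weights sum up to \<open>1\<close>, so the finite values already exhaust the probability.\<close>

lemma AE_finite_immigrants:
  assumes B: "B \<in> sets state_space" and fin: "emeasure immigrant_intensity B \<noteq> \<infinity>"
  shows "AE \<omega> in M. finite {i\<in>{1..}. (\<Gamma> i \<omega>, A i 0 \<omega>) \<in> B}"
proof -
  define E where "E k = {\<omega>\<in>space M. emeasure (immigrant_process \<Gamma> A \<omega>) B = of_nat k}" for k :: nat
  let ?m = "measure immigrant_intensity B"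
  have E [measurable]: "E k \<in> sets M" for k
    unfolding E_def using measurable_compose[OF immigrant_process_measurable measurable_emeasure_point_measure_algebra[OF B]]
    by measurable
  have "(\<lambda>k. prob (E k)) sums prob (\<Union>k. E k)"
    by (rule finite_measure_UNION) (auto simp: disjoint_family_on_def E_def E[unfolded E_def])
  moreover have "prob (E k) = exp (- ?m) * (?m ^ k /\<^sub>R fact k)" for k
    unfolding E_def prob_immigrant_emeasure[OF B fin] by (simp add: field_simps)
  then have "(\<lambda>k. prob (E k)) sums (exp (- ?m) * exp ?m)"
    by (simp only:) (intro sums_mult exp_converges)
  ultimately have "prob (\<Union>k. E k) = 1"
    by (simp add: sums_iff flip: exp_add)
  then have "AE \<omega> in M. \<omega> \<in> (\<Union>k. E k)"
    by (rule AE_prob_1)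
  then show ?thesis
  proof eventually_elim
    case (elim \<omega>)
    then obtain k where "\<omega> \<in> space M" "emeasure (immigrant_process \<Gamma> A \<omega>) B = of_nat k"
      by (auto simp: E_def)
    then have "emeasure (count_space {1..}) {i\<in>{1..}. (\<Gamma> i \<omega>, A i 0 \<omega>) \<in> B} \<noteq> \<infinity>"
      using emeasure_immigrant_process[OF _ B, of \<omega>] by simp
    then show ?case
      using emeasure_count_space_infinite[of "{i\<in>{1..}. (\<Gamma> i \<omega>, A i 0 \<omega>) \<in> B}" "{1..}", OF Collect_restrict]
      by metis
  qed
qed

lemma prob_immigrant_count:
  assumes B: "B \<in> sets state_space" and fin: "emeasure immigrant_intensity B \<noteq> \<infinity>"
  shows "prob {\<omega>\<in>space M. point_count (immigrant_process \<Gamma> A \<omega>) B = k} =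
    measure immigrant_intensity B ^ k / fact k * exp (- measure immigrant_intensity B)"
proof -
  note [measurable] = measurable_compose[OF immigrant_process_measurable measurable_emeasure_point_measure_algebra[OF B]]
    measurable_compose[OF immigrant_process_measurable measurable_point_count[OF B]]
  have "prob {\<omega>\<in>space M. point_count (immigrant_process \<Gamma> A \<omega>) B = k}
      = prob {\<omega>\<in>space M. emeasure (immigrant_process \<Gamma> A \<omega>) B = of_nat k}"
  proof (rule finite_measure_eq_AE)
    show "AE \<omega> in M. (\<omega> \<in> {\<omega>\<in>space M. point_count (immigrant_process \<Gamma> A \<omega>) B = k}) =
        (\<omega> \<in> {\<omega>\<in>space M. emeasure (immigrant_process \<Gamma> A \<omega>) B = of_nat k})"
      using AE_finite_immigrants[OF B fin] AE_space
    proof eventually_elim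
      case (elim \<omega>)
      have "emeasure (count_space {1..}) {i\<in>{1..}. (\<Gamma> i \<omega>, A i 0 \<omega>) \<in> B} =
          of_nat (card {i\<in>{1..}. (\<Gamma> i \<omega>, A i 0 \<omega>) \<in> B})"
        by (rule emeasure_count_space_finite) (use elim in auto)
      then show ?case
        using elim(2) by (simp add: emeasure_immigrant_process[OF _ B] point_count_immigrant_process[OF _ B])
    qed
  qed measurable
  then show ?thesis
    using prob_immigrant_emeasure[OF B fin] by simp
qed

lemma Gamma_mono_le:
  assumes "\<omega> \<in> space M" "1 \<le> i" "i \<le> j"
  shows "\<Gamma> i \<omega> \<le> \<Gamma> j \<omega>"
  using assms(3)
proof (induction j rule: dec_induct)
  case (step n)
  then show ?case
    using Gamma_mono[of n \<omega>] assms by simp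
qed simp

lemma arrival_window:
  assumes "B \<in> sets borel"
  shows "{0..t} \<times> B \<in> sets state_space" "0 \<le> t \<Longrightarrow> emeasure immigrant_intensity ({0..t} \<times> B) = ennreal (\<nu> * t * measure Q B)"
  using assms emeasure_immigrant_intensity[of "{0..t}" t B] by (auto intro: Times_in_sets_state_space)

lemma arrival_number_measurable [measurable]:
  "arrival_number t \<in> M \<rightarrow>\<^sub>M count_space UNIV"
  "arrival_number t \<in> immigrant_algebra \<rightarrow>\<^sub>M count_space UNIV"
  unfolding arrival_number_def[abs_def]
  using measurable_point_count[OF arrival_window(1)[of UNIV t]]
  by (auto intro: measurable_compose[OF immigrant_process_measurable] measurable_immigrant_algebraI)

lemma borel_measurable_arrivals:
  assumes "\<And>n. h n \<in> M \<rightarrow>\<^sub>M N"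
  shows "(\<lambda>\<omega>. h (arrival_number t \<omega>) \<omega>) \<in> M \<rightarrow>\<^sub>M N"
  by (rule measurable_compose_countable[OF assms arrival_number_measurable(1)])

text \<open>The arrival times increase, so a finite set of arrivals up to time \<open>t\<close> is an initial segment. Sums and
products over this random set thereby become sums and products up to a random number.\<close>

lemma AE_arrivals:
  assumes "0 \<le> t"
  shows "AE \<omega> in M. {i. 1 \<le> i \<and> \<Gamma> i \<omega> \<le> t} = {1..arrival_number t \<omega>}"
proof -
  have "AE \<omega> in M. finite {i\<in>{1..}. (\<Gamma> i \<omega>, A i 0 \<omega>) \<in> {0..t} \<times> UNIV}"
    using arrival_window[of UNIV t] assms by (intro AE_finite_immigrants) auto
  with AE_space show ?thesis
  proof eventually_elim
    case (elim \<omega>)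
    let ?S = "{i. 1 \<le> i \<and> \<Gamma> i \<omega> \<le> t}"
    have S: "{i\<in>{1..}. (\<Gamma> i \<omega>, A i 0 \<omega>) \<in> {0..t} \<times> UNIV} = ?S"
      using elim(1) by (auto simp: Gamma_nonneg)
    have fin: "finite ?S"
      using elim(2) unfolding S .
    have "\<exists>n. ?S = {1..n}"
    proof (cases "?S = {}")
      case False
      have "?S = {1..Max ?S}"
      proof (intro equalityI subsetI)
        fix i assume "i \<in> {1..Max ?S}"
        moreover have "Max ?S \<in> ?S"
          using fin False by (rule Max_in)
        ultimately show "i \<in> ?S"
          using Gamma_mono_le[OF elim(1), of i "Max ?S"] by auto
      qed (use fin in auto)
      then show ?thesis ..
    qed (auto intro: exI[of _ 0])
    then obtain n where n: "?S = {1..n}" ..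
    have "arrival_number t \<omega> = card ?S"
      unfolding arrival_number_def S[symmetric]
      by (rule point_count_immigrant_process[OF elim(1)]) (simp add: arrival_window)
    then show ?case
      using n by simp
  qed
qed

section \<open>The generating functional of the immigrants\<close>

text \<open>If \<open>\<phi>\<close> has the values \<open>c\<^sub>0, \<dots>, c\<^sub>n\<^sub>-\<^sub>1\<close>, the product equals \<open>\<Prod>k. c\<^sub>k ^ N\<^sub>k\<close>, where \<open>N\<^sub>k\<close> counts the
immigrants up to time \<open>t\<close> with \<open>\<phi>(mark) = c\<^sub>k\<close>. These counts belong to disjoint windows, so they are
independent Poisson variables, and the generating functions multiply.\<close>

lemma expectation_prod_marks_simple:
  fixes \<phi> :: "'a \<Rightarrow> complex"
  assumes simple: "simple_function borel \<phi>" and bound: "\<And>a. norm (\<phi> a) \<le> 1" and t: "0 \<le> t"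
  shows "expectation (\<lambda>\<omega>. \<Prod>i=1..arrival_number t \<omega>. \<phi> (A i 0 \<omega>)) = exp (of_real (\<nu> * t) * ((LINT a|Q. \<phi> a) - 1))"
proof -
  interpret Q: prob_space Q by (rule Q_prob)
  have \<phi> [measurable]: "\<phi> \<in> borel_measurable borel"
    using simple by (rule borel_measurable_simple_function)
  define n where "n = card (range \<phi>)"
  have "finite (range \<phi>)"
    using simple by (simp add: simple_function_def)
  then obtain c where c: "bij_betw c {..<n} (range \<phi>)"
    using ex_bij_betw_nat_finite[of "range \<phi>"] by (auto simp: n_def atLeast0LessThan)
  have norm_c: "norm (c k) \<le> 1" if "k < n" for k
  proof -
    have "c k \<in> range \<phi>"
      using c that by (auto simp: bij_betw_def)
    then show ?thesis
      using bound by auto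
  qed
  have inj_c: "c j = c k \<longleftrightarrow> j = k" if "j < n" "k < n" for j k
    using c that by (auto simp: bij_betw_def inj_on_def)
  define B where "B k = \<phi> -` {c k}" for k
  have B [measurable]: "B k \<in> sets borel" for k
    unfolding B_def using measurable_sets[OF \<phi>, of "{c k}"] by simp
  define N where "N k \<omega> = point_count (immigrant_process \<Gamma> A \<omega>) ({0..t} \<times> B k)" for k \<omega>
  note W = arrival_window[OF B, where t = t]
  have N [measurable]: "N k \<in> M \<rightarrow>\<^sub>M count_space UNIV" for k
    unfolding N_def[abs_def] using measurable_point_count[OF W(1)] by measurable
  have gen: "expectation (\<lambda>\<omega>. c k ^ N k \<omega>) = exp (of_real (\<nu> * t * measure Q (B k)) * (c k - 1))" if "k < n" for k
  proof (rule poisson_generating_function[OF N])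
    fix j
    have "measure immigrant_intensity ({0..t} \<times> B k) = \<nu> * t * measure Q (B k)"
      using W(2)[OF t] t rate_pos by (simp add: measure_def)
    then show "prob {\<omega> \<in> space M. N k \<omega> = j} =
        (\<nu> * t * measure Q (B k)) ^ j / fact j * exp (- (\<nu> * t * measure Q (B k)))"
      using prob_immigrant_count[OF W(1)[of k], of j] W(2)[OF t, of k] by (simp add: N_def)
  qed (rule norm_c[OF that])
  have "indep_vars (\<lambda>_. borel) (\<lambda>k \<omega>. emeasure (immigrant_process \<Gamma> A \<omega>) ({0..t} \<times> B k)) {..<n}"
  proof -
    have "disjoint_family_on (\<lambda>k. {0..t} \<times> B k) {..<n}"
      using inj_c by (auto simp: disjoint_family_on_def B_def)
    then show ?thesis
      using immigrants W(1) unfolding poisson_point_process_def by simp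
  qed
  then have "indep_vars (\<lambda>_. borel) (\<lambda>k \<omega>. c k ^ nat \<lfloor>enn2real (emeasure (immigrant_process \<Gamma> A \<omega>) ({0..t} \<times> B k))\<rfloor>) {..<n}"
    by (rule indep_vars_compose2[where Y = "\<lambda>k x. c k ^ nat \<lfloor>enn2real x\<rfloor>"]) measurable
  then have indep: "indep_vars (\<lambda>_. borel) (\<lambda>k \<omega>. c k ^ N k \<omega>) {..<n}"
    by (simp add: N_def point_count_def measure_def)
  have "expectation (\<lambda>\<omega>. \<Prod>i=1..arrival_number t \<omega>. \<phi> (A i 0 \<omega>)) = expectation (\<lambda>\<omega>. \<Prod>k<n. c k ^ N k \<omega>)"
  proof (rule integral_cong_AE)
    show "AE \<omega> in M. (\<Prod>i=1..arrival_number t \<omega>. \<phi> (A i 0 \<omega>)) = (\<Prod>k<n. c k ^ N k \<omega>)"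
      using AE_arrivals[OF t] AE_space
    proof eventually_elim
      case (elim \<omega>)
      let ?S = "{1..arrival_number t \<omega>}"
      have "c k ^ N k \<omega> = (\<Prod>i\<in>{i\<in>?S. \<phi> (A i 0 \<omega>) = c k}. \<phi> (A i 0 \<omega>))" for k
      proof -
        have "{i\<in>{1..}. (\<Gamma> i \<omega>, A i 0 \<omega>) \<in> {0..t} \<times> B k} = {i\<in>?S. \<phi> (A i 0 \<omega>) = c k}"
          using elim Gamma_nonneg[of _ \<omega>] by (auto simp: B_def set_eq_iff)
        then show ?thesis
          by (simp add: N_def point_count_immigrant_process[OF elim(2) W(1)])
      qed
      then have "(\<Prod>k<n. c k ^ N k \<omega>) = (\<Prod>k<n. \<Prod>i\<in>{i\<in>?S. \<phi> (A i 0 \<omega>) = c k}. \<phi> (A i 0 \<omega>))"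
        by simp
      also have "\<dots> = (\<Prod>y\<in>range \<phi>. \<Prod>i\<in>{i\<in>?S. \<phi> (A i 0 \<omega>) = y}. \<phi> (A i 0 \<omega>))"
        by (rule prod.reindex_bij_betw[OF c])
      also have "\<dots> = (\<Prod>i\<in>?S. \<phi> (A i 0 \<omega>))"
        using \<open>finite (range \<phi>)\<close> by (intro prod.group) auto
      finally show ?case by simp
    qed
    show "(\<lambda>\<omega>. \<Prod>i=1..arrival_number t \<omega>. \<phi> (A i 0 \<omega>)) \<in> borel_measurable M"
      by (rule borel_measurable_arrivals) (auto intro!: borel_measurable_prod measurable_compose[OF A_measurable])
  qed measurable
  also have "\<dots> = (\<Prod>k<n. expectation (\<lambda>\<omega>. c k ^ N k \<omega>))"
    using norm_c by (intro indep_vars_lebesgue_integral indep) (auto intro!: integrable_unit_disc simp: norm_power power_le_one)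
  also have "\<dots> = exp (of_real (\<nu> * t) * (\<Sum>k<n. of_real (measure Q (B k)) * (c k - 1)))"
    using gen by (simp add: exp_sum sum_distrib_left mult.assoc)
  also have "(\<Sum>k<n. of_real (measure Q (B k)) * (c k - 1)) = (LINT a|Q. \<phi> a) - 1"
  proof -
    have Bq: "B k \<in> sets Q" for k using B Q_sets by simp
    have "(\<Sum>k<n. of_real (measure Q (B k)) * (c k - 1)) = (\<Sum>k<n. (LINT a|Q. indicator (B k) a *\<^sub>R (c k - 1)))"
      using Bq by (intro sum.cong) (simp_all add: scaleR_conv_of_real)
    also have "\<dots> = (LINT a|Q. (\<Sum>k<n. indicator (B k) a *\<^sub>R (c k - 1)))"
      using Bq by (intro Bochner_Integration.integral_sum[symmetric] integrable_scaleR_left integrable_real_indicator) 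
        (auto simp: less_top[symmetric])
    also have "\<dots> = (LINT a|Q. \<phi> a - 1)"
    proof (rule Bochner_Integration.integral_cong)
      fix a
      obtain j where j: "j < n" "\<phi> a = c j"
        using c by (metis bij_betw_imp_surj_on imageE lessThan_iff rangeI)
      have "(\<Sum>k<n. indicator (B k) a *\<^sub>R (c k - 1)) = (\<Sum>k<n. if k = j then c k - 1 else 0)"
        using j inj_c by (intro sum.cong) (auto simp: B_def indicator_def)
      also have "\<dots> = \<phi> a - 1"
        using j by simp
      finally show "(\<Sum>k<n. indicator (B k) a *\<^sub>R (c k - 1)) = \<phi> a - 1" .
    qed simp
    also have "\<dots> = (LINT a|Q. \<phi> a) - 1"
    proof -
      have "integrable Q \<phi>"
        by (rule Q.integrable_unit_disc) (use \<phi> Q_sets bound in \<open>auto cong: measurable_cong_sets\<close>)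
      then show ?thesis
        by (simp add: Q.prob_space)
    qed
    finally show ?thesis .
  qed
  finally show ?thesis .
qed

text \<open>The generating functional of the Poisson process, obtained from simple \<open>\<phi>\<close> by dominated convergence.\<close>

proposition expectation_prod_marks:
  fixes \<phi> :: "'a \<Rightarrow> complex"
  assumes \<phi>: "\<phi> \<in> borel_measurable borel" and bound: "\<And>a. norm (\<phi> a) \<le> 1" and t: "0 \<le> t"
  shows "expectation (\<lambda>\<omega>. \<Prod>i=1..arrival_number t \<omega>. \<phi> (A i 0 \<omega>)) = exp (of_real (\<nu> * t) * ((LINT a|Q. \<phi> a) - 1))"
proof -
  interpret Q: prob_space Q by (rule Q_prob)
  obtain s where s: "\<And>n. simple_function borel (s n)" "\<And>n a. norm (s n a) \<le> 1"
      "\<And>a. (\<lambda>n. s n a) \<longlonglongrightarrow> \<phi> a"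
    using unit_disc_simple_approximation[OF \<phi> bound] by (metis UNIV_I space_borel)
  have s_meas: "s n \<in> borel_measurable borel" for n
    using s(1) by (rule borel_measurable_simple_function)
  have prod_meas: "(\<lambda>\<omega>. \<Prod>i=1..arrival_number t \<omega>. h (A i 0 \<omega>)) \<in> borel_measurable M"
    if "h \<in> borel_measurable borel" for h :: "'a \<Rightarrow> complex"
    by (rule borel_measurable_arrivals)
      (auto intro!: borel_measurable_prod measurable_compose[OF A_measurable] that)
  have "(\<lambda>n. expectation (\<lambda>\<omega>. \<Prod>i=1..arrival_number t \<omega>. s n (A i 0 \<omega>)))
      \<longlonglongrightarrow> expectation (\<lambda>\<omega>. \<Prod>i=1..arrival_number t \<omega>. \<phi> (A i 0 \<omega>))"
    by (rule expectation_tendsto_unit_disc)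
      (use prod_meas s_meas \<phi> s in \<open>auto intro!: tendsto_prod simp: prod_norm[symmetric] prod_le_1\<close>)
  moreover have "(\<lambda>n. expectation (\<lambda>\<omega>. \<Prod>i=1..arrival_number t \<omega>. s n (A i 0 \<omega>)))
      \<longlonglongrightarrow> exp (of_real (\<nu> * t) * ((LINT a|Q. \<phi> a) - 1))"
  proof -
    have "(\<lambda>n. LINT a|Q. s n a) \<longlonglongrightarrow> (LINT a|Q. \<phi> a)"
      by (rule Q.expectation_tendsto_unit_disc)
        (use s_meas \<phi> s Q_sets in \<open>auto cong: measurable_cong_sets\<close>)
    then have "(\<lambda>n. exp (of_real (\<nu> * t) * ((LINT a|Q. s n a) - 1)))
        \<longlonglongrightarrow> exp (of_real (\<nu> * t) * ((LINT a|Q. \<phi> a) - 1))"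
      by (intro tendsto_intros)
    then show ?thesis
      using expectation_prod_marks_simple[OF s(1,2) t] by simp
  qed
  ultimately show ?thesis
    by (rule LIMSEQ_unique)
qed

section \<open>Averaging the offspring processes\<close>

lemma kernel_prob_space: "prob_space (\<kappa> a)" and sets_kernel: "sets (\<kappa> a) = sets point_measure_algebra"
  using measurable_space[OF kernel, of a] by (auto simp: space_prob_algebra)

lemma space_kernel: "space (\<kappa> a) = space point_measure_algebra"
  by (rule sets_eq_imp_space_eq[OF sets_kernel])

lemma borel_measurable_kernel:
  "(h \<in> borel_measurable (\<kappa> a)) = (h \<in> borel_measurable point_measure_algebra)"
  by (rule arg_cong[where f = "\<lambda>S. h \<in> S"], rule measurable_cong_sets[OF sets_kernel refl])

lemma kernel_integral_measurable:
  fixes g :: "(real \<times> 'a) measure \<Rightarrow> complex"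
  assumes "g \<in> borel_measurable point_measure_algebra"
  shows "(\<lambda>a. LINT \<mu>|\<kappa> a. g \<mu>) \<in> borel_measurable borel"
  by (rule measurable_compose[OF measurable_prob_algebraD[OF kernel] integral_measurable_subprob_algebra[OF assms]])

lemma kernel_measure_measurable:
  assumes "B \<in> sets point_measure_algebra"
  shows "(\<lambda>a. measure (\<kappa> a) B) \<in> borel_measurable borel"
  by (rule measurable_compose[OF measurable_prob_algebraD[OF kernel] measurable_measure_subprob_algebra[OF assms]])

lemma norm_kernel_integral:
  fixes g :: "(real \<times> 'a) measure \<Rightarrow> complex"
  assumes "g \<in> borel_measurable point_measure_algebra" "\<And>\<mu>. \<mu> \<in> space point_measure_algebra \<Longrightarrow> norm (g \<mu>) \<le> 1"
  shows "norm (LINT \<mu>|\<kappa> a. g \<mu>) \<le> 1"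
  using assms by (intro prob_space.norm_expectation_unit_disc[OF kernel_prob_space])
    (auto simp: borel_measurable_kernel space_kernel)

lemma offspring_points:
  "1 \<le> i \<Longrightarrow> \<omega> \<in> space M \<Longrightarrow> (\<lambda>j. (T i j \<omega>, A i j \<omega>)) \<in> {1..K i \<omega>} \<rightarrow> space state_space"
  by (auto simp: space_state_space T_nonneg)

lemma offspring_process_measurable:
  assumes i: "1 \<le> i"
  shows "offspring_process K T A i \<in> M \<rightarrow>\<^sub>M point_measure_algebra"
proof (rule measurable_point_measure_algebraI)
  show "offspring_process K T A i \<omega> \<in> point_measures" if "\<omega> \<in> space M" for \<omega>
    unfolding offspring_process_def using offspring_points[OF i that]
    by (intro point_measure_in_point_measures) auto
  fix B assume B: "B \<in> sets (state_space :: (real \<times> 'a) measure)"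
  \<comment> \<open>\<open>T i j\<close> may be negative for \<open>j > K i\<close>; truncating it there stays inside the state space and
    leaves the actual points unchanged.\<close>
  have "(\<lambda>\<omega>. (max 0 (T i j \<omega>), A i j \<omega>)) \<in> M \<rightarrow>\<^sub>M state_space" for j
    using T_measurable[OF i] A_measurable[OF i] by (intro Pair_measurable_state_space) auto
  note [measurable] = measurable_compose[OF this borel_measurable_indicator[OF B]]
  have "(\<lambda>\<omega>. \<Sum>j=1..K i \<omega>. indicator B (max 0 (T i j \<omega>), A i j \<omega>) :: ennreal) \<in> borel_measurable M"
    by (rule measurable_compose_countable[where f = "\<lambda>n \<omega>. \<Sum>j=1..n. indicator B (max 0 (T i j \<omega>), A i j \<omega>)",
          OF _ K_measurable[OF i]]) measurable
  moreover have "emeasure (offspring_process K T A i \<omega>) B =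
      (\<Sum>j=1..K i \<omega>. indicator B (max 0 (T i j \<omega>), A i j \<omega>))" if \<omega>: "\<omega> \<in> space M" for \<omega>
  proof -
    have "emeasure (offspring_process K T A i \<omega>) B = (\<integral>\<^sup>+p. indicator B p \<partial>offspring_process K T A i \<omega>)"
      using B by (simp add: offspring_process_def sets_point_measure)
    also have "\<dots> = (\<Sum>j=1..K i \<omega>. indicator B (T i j \<omega>, A i j \<omega>))"
      unfolding offspring_process_def
      by (subst nn_integral_point_measure[OF offspring_points[OF i \<omega>]])
        (use B in \<open>auto simp: nn_integral_count_space_finite\<close>)
    also have "\<dots> = (\<Sum>j=1..K i \<omega>. indicator B (max 0 (T i j \<omega>), A i j \<omega>))"
      using T_nonneg[OF i \<omega>] by (intro sum.cong) (auto simp: max_def)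
    finally show ?thesis .
  qed
  ultimately show "(\<lambda>\<omega>. emeasure (offspring_process K T A i \<omega>) B) \<in> borel_measurable M"
    by (simp cong: measurable_cong)
qed

text \<open>The conditional law of the clusters, integrated against a weight that depends on the immigrants only. The
conditional expectation is real, hence the passage to real and imaginary parts.\<close>

lemma expectation_offspring_events:
  fixes W :: "'w \<Rightarrow> complex"
  assumes W: "W \<in> borel_measurable immigrant_algebra" and W_bound: "\<And>\<omega>. \<omega> \<in> space M \<Longrightarrow> norm (W \<omega>) \<le> 1"
    and J: "finite J" "J \<subseteq> {1..}" and B: "\<And>i. i \<in> J \<Longrightarrow> B i \<in> sets point_measure_algebra"
  shows "expectation (\<lambda>\<omega>. W \<omega> * of_real (\<Prod>i\<in>J. indicator (B i) (offspring_process K T A i \<omega>)))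
       = expectation (\<lambda>\<omega>. W \<omega> * of_real (\<Prod>i\<in>J. measure (\<kappa> (A i 0 \<omega>)) (B i)))"
proof -
  interpret finite_measure_subalgebra M immigrant_algebra
    by unfold_locales (rule immigrant_subalgebra)
  define H where "H = {\<omega>\<in>space M. \<forall>i\<in>J. offspring_process K T A i \<omega> \<in> B i}"
  define p where "p \<omega> = (\<Prod>i\<in>J. measure (\<kappa> (A i 0 \<omega>)) (B i))" for \<omega>
  have W_M [measurable]: "W \<in> borel_measurable M"
    by (rule measurable_from_subalg[OF immigrant_subalgebra W])
  have "offspring_process K T A i -` B i \<inter> space M \<in> sets M" if "i \<in> J" for i
    using that J B by (intro measurable_sets[OF offspring_process_measurable]) auto
  then have H [measurable]: "H \<in> sets M"
    unfolding H_def using J by (intro sets.sets_Collect_finite_All) (auto simp: vimage_def Int_def conj_commute)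
  have p [measurable]: "p \<in> borel_measurable M"
    unfolding p_def using J B
    by (intro borel_measurable_prod measurable_compose[OF A_measurable kernel_measure_measurable]) auto
  have p_bound: "0 \<le> p \<omega>" "p \<omega> \<le> 1" for \<omega>
    unfolding p_def using prob_space.prob_le_1[OF kernel_prob_space] by (auto intro: prod_nonneg prod_le_1)
  have ind: "(\<Prod>i\<in>J. indicator (B i) (offspring_process K T A i \<omega>)) = (indicator H \<omega> :: real)" if "\<omega> \<in> space M" for \<omega>
  proof (cases "\<omega> \<in> H")
    case True
    then show ?thesis by (simp add: H_def)
  next
    case False
    with that obtain i where "i \<in> J" "offspring_process K T A i \<omega> \<notin> B i"
      by (auto simp: H_def)
    with False J(1) show ?thesis
      by (auto intro!: prod_zero bexI[of _ i])
  qed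
  have law: "AE \<omega> in M. real_cond_exp M immigrant_algebra (indicator H) \<omega> = p \<omega>"
    unfolding H_def p_def by (rule cluster_law[OF J]) (rule B)
  have real: "expectation (\<lambda>\<omega>. w \<omega> * indicator H \<omega>) = expectation (\<lambda>\<omega>. w \<omega> * p \<omega>)"
    if w: "w \<in> borel_measurable immigrant_algebra" and wb: "\<And>\<omega>. \<omega> \<in> space M \<Longrightarrow> \<bar>w \<omega>\<bar> \<le> 1" for w :: "'w \<Rightarrow> real"
  proof -
    have [measurable]: "w \<in> borel_measurable M"
      by (rule measurable_from_subalg[OF immigrant_subalgebra w])
    have "integrable M (\<lambda>\<omega>. w \<omega> * indicator H \<omega>)"
      using wb by (intro integrable_const_bound[of _ 1]) (auto simp: indicator_def)
    from real_cond_exp_intg(2)[OF this w]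
    have "expectation (\<lambda>\<omega>. w \<omega> * indicator H \<omega>) = expectation (\<lambda>\<omega>. w \<omega> * real_cond_exp M immigrant_algebra (indicator H) \<omega>)"
      by simp
    also have "\<dots> = expectation (\<lambda>\<omega>. w \<omega> * p \<omega>)"
    proof (rule integral_cong_AE)
      show "AE \<omega> in M. w \<omega> * real_cond_exp M immigrant_algebra (indicator H) \<omega> = w \<omega> * p \<omega>"
        using law by eventually_elim simp
    qed measurable
    finally show ?thesis .
  qed
  have W_Re: "(\<lambda>\<omega>. Re (W \<omega>)) \<in> borel_measurable immigrant_algebra"
    and W_Im: "(\<lambda>\<omega>. Im (W \<omega>)) \<in> borel_measurable immigrant_algebra"
    using W by measurable
  have bRe: "\<bar>Re (W \<omega>)\<bar> \<le> 1" and bIm: "\<bar>Im (W \<omega>)\<bar> \<le> 1" if "\<omega> \<in> space M" for \<omega>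
    using W_bound[OF that] abs_Re_le_cmod[of "W \<omega>"] abs_Im_le_cmod[of "W \<omega>"] by linarith+
  have int1: "integrable M (\<lambda>\<omega>. W \<omega> * of_real (indicator H \<omega>))"
    using W_bound by (intro integrable_unit_disc) (auto simp: indicator_def norm_mult)
  have int2: "integrable M (\<lambda>\<omega>. W \<omega> * of_real (p \<omega>))"
    using W_bound p_bound by (intro integrable_unit_disc) (auto simp: norm_mult mult_le_one)
  have "expectation (\<lambda>\<omega>. W \<omega> * of_real (indicator H \<omega>)) = expectation (\<lambda>\<omega>. W \<omega> * of_real (p \<omega>))"
  proof (rule complex_eqI)
    show "Re (expectation (\<lambda>\<omega>. W \<omega> * of_real (indicator H \<omega>))) = Re (expectation (\<lambda>\<omega>. W \<omega> * of_real (p \<omega>)))"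
      using real[OF W_Re bRe] int1 int2 by (simp flip: integral_Re)
    show "Im (expectation (\<lambda>\<omega>. W \<omega> * of_real (indicator H \<omega>))) = Im (expectation (\<lambda>\<omega>. W \<omega> * of_real (p \<omega>)))"
      using real[OF W_Im bIm] int1 int2 by (simp flip: integral_Im)
  qed
  then show ?thesis
    unfolding p_def using ind by (simp cong: Bochner_Integration.integral_cong)
qed

text \<open>Expanding over the values of a simple \<open>g\<close> expresses both sides through the same finite linear combination
of events and of their kernel probabilities.\<close>

lemma expectation_offspring_simple:
  fixes W :: "'w \<Rightarrow> complex" and g :: "(real \<times> 'a) measure \<Rightarrow> complex"
  assumes W: "W \<in> borel_measurable immigrant_algebra" and W_bound: "\<And>\<omega>. \<omega> \<in> space M \<Longrightarrow> norm (W \<omega>) \<le> 1"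
    and J: "finite J" "J \<subseteq> {1..}" and g: "simple_function point_measure_algebra g"
  shows "expectation (\<lambda>\<omega>. W \<omega> * (\<Prod>i\<in>J. g (offspring_process K T A i \<omega>)))
       = expectation (\<lambda>\<omega>. W \<omega> * (\<Prod>i\<in>J. LINT \<mu>|\<kappa> (A i 0 \<omega>). g \<mu>))"
proof -
  define C where "C = g ` space point_measure_algebra"
  define B where "B c = g -` {c} \<inter> space point_measure_algebra" for c
  have C: "finite C"
    using g by (simp add: C_def simple_function_def)
  have B: "B c \<in> sets point_measure_algebra" for c
    unfolding B_def using g by (rule simple_functionD)
  have W_M [measurable]: "W \<in> borel_measurable M"
    by (rule measurable_from_subalg[OF immigrant_subalgebra W])
  have g_eq: "g \<mu> = (\<Sum>c\<in>C. c * of_real (indicator (B c) \<mu>))" if "\<mu> \<in> space point_measure_algebra" for \<mu>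
  proof -
    have "(\<Sum>c\<in>C. c * of_real (indicator (B c) \<mu>)) = (\<Sum>c\<in>C. if c = g \<mu> then c else 0)"
      using that by (intro sum.cong) (auto simp: B_def indicator_def)
    then show ?thesis
      using that C by (simp add: C_def)
  qed
  have kg_eq: "(LINT \<mu>|\<kappa> a. g \<mu>) = (\<Sum>c\<in>C. c * of_real (measure (\<kappa> a) (B c)))" for a
  proof -
    interpret k: prob_space "\<kappa> a" by (rule kernel_prob_space)
    have Bk: "B c \<in> sets (\<kappa> a)" for c using B by (simp add: sets_kernel)
    have "(LINT \<mu>|\<kappa> a. g \<mu>) = (LINT \<mu>|\<kappa> a. (\<Sum>c\<in>C. c * of_real (indicator (B c) \<mu>)))"
      by (rule Bochner_Integration.integral_cong) (auto simp: space_kernel g_eq)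
    also have "\<dots> = (\<Sum>c\<in>C. (LINT \<mu>|\<kappa> a. c * of_real (indicator (B c) \<mu>)))"
      using Bk by (intro Bochner_Integration.integral_sum integrable_mult_right k.integrable_unit_disc)
        (auto simp: indicator_def)
    also have "\<dots> = (\<Sum>c\<in>C. c * of_real (measure (\<kappa> a) (B c)))"
      using Bk by (simp add: integral_complex_of_real)
    finally show ?thesis .
  qed
  have expand: "expectation (\<lambda>\<omega>. W \<omega> * (\<Prod>i\<in>J. x i \<omega>))
      = (\<Sum>q\<in>J \<rightarrow>\<^sub>E C. (\<Prod>i\<in>J. q i) * expectation (\<lambda>\<omega>. W \<omega> * of_real (\<Prod>i\<in>J. p i (q i) \<omega>)))"
    if x: "\<And>i \<omega>. i \<in> J \<Longrightarrow> \<omega> \<in> space M \<Longrightarrow> x i \<omega> = (\<Sum>c\<in>C. c * of_real (p i c \<omega>))"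
      and p: "\<And>i c. i \<in> J \<Longrightarrow> p i c \<in> borel_measurable M"
      and pb: "\<And>i c \<omega>. 0 \<le> p i c \<omega>" "\<And>i c \<omega>. p i c \<omega> \<le> 1"
    for x :: "nat \<Rightarrow> 'w \<Rightarrow> complex" and p :: "nat \<Rightarrow> complex \<Rightarrow> 'w \<Rightarrow> real"
  proof -
    have "expectation (\<lambda>\<omega>. W \<omega> * (\<Prod>i\<in>J. x i \<omega>))
        = expectation (\<lambda>\<omega>. \<Sum>q\<in>J \<rightarrow>\<^sub>E C. (\<Prod>i\<in>J. q i) * (W \<omega> * of_real (\<Prod>i\<in>J. p i (q i) \<omega>)))"
    proof (rule Bochner_Integration.integral_cong)
      fix \<omega> assume "\<omega> \<in> space M"
      then have "(\<Prod>i\<in>J. x i \<omega>) = (\<Sum>q\<in>J \<rightarrow>\<^sub>E C. (\<Prod>i\<in>J. q i) * (\<Prod>i\<in>J. of_real (p i (q i) \<omega>)))"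
        using prod_sum_expand[OF J(1) C, of "\<lambda>i. x i \<omega>" "\<lambda>i c. of_real (p i c \<omega>)"] x by simp
      then show "W \<omega> * (\<Prod>i\<in>J. x i \<omega>) = (\<Sum>q\<in>J \<rightarrow>\<^sub>E C. (\<Prod>i\<in>J. q i) * (W \<omega> * of_real (\<Prod>i\<in>J. p i (q i) \<omega>)))"
        by (simp add: sum_distrib_left mult_ac)
    qed simp
    also have "\<dots> = (\<Sum>q\<in>J \<rightarrow>\<^sub>E C. expectation (\<lambda>\<omega>. (\<Prod>i\<in>J. q i) * (W \<omega> * of_real (\<Prod>i\<in>J. p i (q i) \<omega>))))"
    proof (intro Bochner_Integration.integral_sum integrable_mult_right integrable_unit_disc)
      fix q \<omega> assume "\<omega> \<in> space M"
      have "0 \<le> (\<Prod>i\<in>J. p i (q i) \<omega>)" "(\<Prod>i\<in>J. p i (q i) \<omega>) \<le> 1"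
        using pb by (auto intro: prod_nonneg prod_le_1)
      then show "norm (W \<omega> * of_real (\<Prod>i\<in>J. p i (q i) \<omega>)) \<le> 1"
        using W_bound[OF \<open>\<omega> \<in> space M\<close>] by (simp add: norm_mult mult_le_one del: of_real_prod)
    next
      fix q
      have [measurable]: "(\<lambda>\<omega>. \<Prod>i\<in>J. p i (q i) \<omega>) \<in> borel_measurable M"
        using p by (intro borel_measurable_prod)
      show "(\<lambda>\<omega>. W \<omega> * of_real (\<Prod>i\<in>J. p i (q i) \<omega>)) \<in> borel_measurable M"
        by measurable
    qed
    finally show ?thesis by simp
  qed
  have "expectation (\<lambda>\<omega>. W \<omega> * (\<Prod>i\<in>J. g (offspring_process K T A i \<omega>)))
      = (\<Sum>q\<in>J \<rightarrow>\<^sub>E C. (\<Prod>i\<in>J. q i) *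
          expectation (\<lambda>\<omega>. W \<omega> * of_real (\<Prod>i\<in>J. indicator (B (q i)) (offspring_process K T A i \<omega>))))"
  proof (rule expand)
    fix i c assume "i \<in> J"
    then have i: "1 \<le> i" using J by auto
    show "(\<lambda>\<omega>. indicator (B c) (offspring_process K T A i \<omega>) :: real) \<in> borel_measurable M"
      by (rule measurable_compose[OF offspring_process_measurable[OF i] borel_measurable_indicator[OF B]])
    show "g (offspring_process K T A i \<omega>) = (\<Sum>c\<in>C. c * of_real (indicator (B c) (offspring_process K T A i \<omega>)))"
      if "\<omega> \<in> space M" for \<omega>
      by (rule g_eq, rule measurable_space[OF offspring_process_measurable[OF i] that])
  qed auto
  also have "\<dots> = (\<Sum>q\<in>J \<rightarrow>\<^sub>E C. (\<Prod>i\<in>J. q i) *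
          expectation (\<lambda>\<omega>. W \<omega> * of_real (\<Prod>i\<in>J. measure (\<kappa> (A i 0 \<omega>)) (B (q i)))))"
    by (intro sum.cong refl arg_cong2[where f = "(*)"] expectation_offspring_events W W_bound J B)
  also have "\<dots> = expectation (\<lambda>\<omega>. W \<omega> * (\<Prod>i\<in>J. LINT \<mu>|\<kappa> (A i 0 \<omega>). g \<mu>))"
  proof (rule expand[symmetric])
    fix i c assume "i \<in> J"
    then have i: "1 \<le> i" using J by auto
    show "(\<lambda>\<omega>. measure (\<kappa> (A i 0 \<omega>)) (B c)) \<in> borel_measurable M"
      by (rule measurable_compose[OF A_measurable[OF i] kernel_measure_measurable[OF B]])
  qed (auto simp: kg_eq prob_space.prob_le_1[OF kernel_prob_space])
  finally show ?thesis .
qed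

text \<open>Given the immigrants, each offspring process may be averaged out with its own kernel; the weight \<open>W\<close>
carries whatever depends on the immigrants only.\<close>

proposition expectation_offspring:
  fixes W :: "'w \<Rightarrow> complex" and g :: "(real \<times> 'a) measure \<Rightarrow> complex"
  assumes W: "W \<in> borel_measurable immigrant_algebra" and W_bound: "\<And>\<omega>. \<omega> \<in> space M \<Longrightarrow> norm (W \<omega>) \<le> 1"
    and J: "finite J" "J \<subseteq> {1..}" and g: "g \<in> borel_measurable point_measure_algebra"
    and g_bound: "\<And>\<mu>. \<mu> \<in> space point_measure_algebra \<Longrightarrow> norm (g \<mu>) \<le> 1"
  shows "expectation (\<lambda>\<omega>. W \<omega> * (\<Prod>i\<in>J. g (offspring_process K T A i \<omega>)))
       = expectation (\<lambda>\<omega>. W \<omega> * (\<Prod>i\<in>J. LINT \<mu>|\<kappa> (A i 0 \<omega>). g \<mu>))"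
proof -
  obtain s where s: "\<And>n. simple_function point_measure_algebra (s n)" "\<And>n \<mu>. norm (s n \<mu>) \<le> 1"
      "\<And>\<mu>. \<mu> \<in> space point_measure_algebra \<Longrightarrow> (\<lambda>n. s n \<mu>) \<longlonglongrightarrow> g \<mu>"
    using unit_disc_simple_approximation[OF g g_bound] by metis
  have s_meas: "s n \<in> borel_measurable point_measure_algebra" for n
    using s(1) by (rule borel_measurable_simple_function)
  have W_M [measurable]: "W \<in> borel_measurable M"
    by (rule measurable_from_subalg[OF immigrant_subalgebra W])
  have lim: "(\<lambda>n. expectation (\<lambda>\<omega>. W \<omega> * (\<Prod>i\<in>J. x n i \<omega>))) \<longlonglongrightarrow> expectation (\<lambda>\<omega>. W \<omega> * (\<Prod>i\<in>J. y i \<omega>))"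
    if x: "\<And>n i. i \<in> J \<Longrightarrow> x n i \<in> borel_measurable M" and y: "\<And>i. i \<in> J \<Longrightarrow> y i \<in> borel_measurable M"
      and xb: "\<And>n i \<omega>. i \<in> J \<Longrightarrow> norm (x n i \<omega>) \<le> 1"
      and xy: "\<And>i \<omega>. i \<in> J \<Longrightarrow> \<omega> \<in> space M \<Longrightarrow> (\<lambda>n. x n i \<omega>) \<longlonglongrightarrow> y i \<omega>"
    for x :: "nat \<Rightarrow> nat \<Rightarrow> 'w \<Rightarrow> complex" and y :: "nat \<Rightarrow> 'w \<Rightarrow> complex"
  proof (rule expectation_tendsto_unit_disc)
    have [measurable]: "(\<lambda>\<omega>. \<Prod>i\<in>J. x n i \<omega>) \<in> borel_measurable M" "(\<lambda>\<omega>. \<Prod>i\<in>J. y i \<omega>) \<in> borel_measurable M" for n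
      using x y by (auto intro: borel_measurable_prod)
    show "(\<lambda>\<omega>. W \<omega> * (\<Prod>i\<in>J. x n i \<omega>)) \<in> borel_measurable M"
      "(\<lambda>\<omega>. W \<omega> * (\<Prod>i\<in>J. y i \<omega>)) \<in> borel_measurable M" for n
      by measurable
    fix \<omega> assume \<omega>: "\<omega> \<in> space M"
    show "norm (W \<omega> * (\<Prod>i\<in>J. x n i \<omega>)) \<le> 1" for n
      using W_bound[OF \<omega>] xb by (auto simp: norm_mult prod_norm[symmetric] intro!: mult_le_one prod_le_1 prod_nonneg)
    show "(\<lambda>n. W \<omega> * (\<Prod>i\<in>J. x n i \<omega>)) \<longlonglongrightarrow> W \<omega> * (\<Prod>i\<in>J. y i \<omega>)"
      using xy \<omega> by (intro tendsto_intros) auto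
  qed
  have "(\<lambda>n. expectation (\<lambda>\<omega>. W \<omega> * (\<Prod>i\<in>J. s n (offspring_process K T A i \<omega>))))
      \<longlonglongrightarrow> expectation (\<lambda>\<omega>. W \<omega> * (\<Prod>i\<in>J. g (offspring_process K T A i \<omega>)))"
  proof (rule lim)
    fix i assume "i \<in> J"
    then have i: "1 \<le> i" using J by auto
    note off = offspring_process_measurable[OF i]
    show "(\<lambda>\<omega>. s n (offspring_process K T A i \<omega>)) \<in> borel_measurable M"
      "(\<lambda>\<omega>. g (offspring_process K T A i \<omega>)) \<in> borel_measurable M" for n
      using measurable_compose[OF off s_meas] measurable_compose[OF off g] .
    show "(\<lambda>n. s n (offspring_process K T A i \<omega>)) \<longlonglongrightarrow> g (offspring_process K T A i \<omega>)" if "\<omega> \<in> space M" for \<omega>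
      using measurable_space[OF off that] by (rule s(3))
  qed (rule s(2))
  then have "(\<lambda>n. expectation (\<lambda>\<omega>. W \<omega> * (\<Prod>i\<in>J. LINT \<mu>|\<kappa> (A i 0 \<omega>). s n \<mu>)))
      \<longlonglongrightarrow> expectation (\<lambda>\<omega>. W \<omega> * (\<Prod>i\<in>J. g (offspring_process K T A i \<omega>)))"
    by (rule Lim_transform_eventually)
      (intro always_eventually allI expectation_offspring_simple W W_bound J s(1))
  moreover have "(\<lambda>n. expectation (\<lambda>\<omega>. W \<omega> * (\<Prod>i\<in>J. LINT \<mu>|\<kappa> (A i 0 \<omega>). s n \<mu>)))
      \<longlonglongrightarrow> expectation (\<lambda>\<omega>. W \<omega> * (\<Prod>i\<in>J. LINT \<mu>|\<kappa> (A i 0 \<omega>). g \<mu>))"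
  proof (rule lim)
    fix i assume "i \<in> J"
    then have i: "1 \<le> i" using J by auto
    note Ai = A_measurable[OF i]
    show "(\<lambda>\<omega>. LINT \<mu>|\<kappa> (A i 0 \<omega>). s n \<mu>) \<in> borel_measurable M"
      "(\<lambda>\<omega>. LINT \<mu>|\<kappa> (A i 0 \<omega>). g \<mu>) \<in> borel_measurable M" for n
      using measurable_compose[OF Ai kernel_integral_measurable[OF s_meas]]
        measurable_compose[OF Ai kernel_integral_measurable[OF g]] .
    show "norm (LINT \<mu>|\<kappa> (A i 0 \<omega>). s n \<mu>) \<le> 1" for n \<omega>
      using s_meas s(2) by (rule norm_kernel_integral)
    show "(\<lambda>n. LINT \<mu>|\<kappa> (A i 0 \<omega>). s n \<mu>) \<longlonglongrightarrow> (LINT \<mu>|\<kappa> (A i 0 \<omega>). g \<mu>)" for \<omega>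
      by (rule prob_space.expectation_tendsto_unit_disc[OF kernel_prob_space])
        (use s_meas g s in \<open>auto simp: borel_measurable_kernel space_kernel\<close>)
  qed
  ultimately show ?thesis
    by (rule LIMSEQ_unique)
qed

section \<open>The mark of the first immigrant\<close>

lemma prob_no_immigrants:
  assumes "B \<in> sets state_space" "emeasure immigrant_intensity B = ennreal m" "0 \<le> m"
  shows "prob {\<omega>\<in>space M. emeasure (immigrant_process \<Gamma> A \<omega>) B = 0} = exp (- m)"
  using prob_immigrant_emeasure[OF assms(1), of 0] assms(2,3) by (simp add: measure_def)

lemma no_immigrants_iff:
  assumes "\<omega> \<in> space M" "B \<in> sets state_space"
  shows "emeasure (immigrant_process \<Gamma> A \<omega>) B = 0 \<longleftrightarrow> (\<forall>i\<ge>1. (\<Gamma> i \<omega>, A i 0 \<omega>) \<notin> B)"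
proof -
  have "emeasure (immigrant_process \<Gamma> A \<omega>) B = 0 \<longleftrightarrow> {i\<in>{1..}. (\<Gamma> i \<omega>, A i 0 \<omega>) \<in> B} = {}"
    unfolding emeasure_immigrant_process[OF assms] by (simp only: emeasure_count_space_eq_0 Collect_restrict simp_thms)
  then show ?thesis
    by auto
qed

lemma no_immigrants_sets:
  assumes "B \<in> sets state_space"
  shows "{\<omega>\<in>space M. emeasure (immigrant_process \<Gamma> A \<omega>) B = 0} \<in> sets immigrant_algebra"
proof -
  have "(\<lambda>\<omega>. emeasure (immigrant_process \<Gamma> A \<omega>) B) \<in> borel_measurable immigrant_algebra"
    by (rule measurable_immigrant_algebraI) (rule measurable_emeasure_point_measure_algebra[OF assms])
  from measurable_sets[OF this, of "{0}"] show ?thesis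
    by (simp add: vimage_def Int_def conj_commute)
qed

text \<open>Cut time into intervals of length \<open>h\<close>. If there is no immigrant before time \<open>k h\<close>, and at least one in
\<open>[k h, (k + 1) h)\<close>, and all of those have marks in \<open>B\<close>, then the first mark lies in \<open>B\<close>. The union over
\<open>k\<close> of these disjoint events is \<open>E\<close>. Each of them is the difference of two nested events that some set
contains no immigrants, so void probabilities suffice. With \<open>q = Q B\<close> the geometric series gives
\<open>(exp (- \<nu> h (1 - q)) - exp (- \<nu> h)) / (1 - exp (- \<nu> h))\<close>, which is at least \<open>exp (- \<nu> h) q\<close> because
\<open>exp x - 1 \<ge> x\<close> and \<open>1 - exp (- x) \<le> x\<close>.\<close>

lemma first_mark_approximation:
  assumes B: "B \<in> sets borel" and h: "0 < h"
  obtains E where "E \<in> sets immigrant_algebra" "E \<subseteq> {\<omega>\<in>space M. A 1 0 \<omega> \<in> B}"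
    "exp (- (\<nu> * h)) * measure Q B \<le> prob E"
proof -
  interpret Q: prob_space Q by (rule Q_prob)
  define q where "q = measure Q B"
  define V where "V k = {0..<real k * h} \<times> UNIV \<union> {real k * h..<real (Suc k) * h} \<times> (- B)" for k
  define U where "U k = {0..<real (Suc k) * h} \<times> (UNIV :: 'a set)" for k
  define Z where "Z S = {\<omega>\<in>space M. emeasure (immigrant_process \<Gamma> A \<omega>) S = 0}" for S
  define E where "E k = Z (V k) - Z (U k)" for k
  have nn: "0 \<le> real k * h" "real k * h \<le> real (Suc k) * h" for k
    using h by (auto intro: mult_right_mono)
  have Bc: "- B \<in> sets borel"
    using B by (simp add: Compl_eq_Diff_UNIV)
  have qc: "measure Q (- B) = 1 - q"
    using Q.prob_compl[of B] B Q_sets sets_eq_imp_space_eq[OF Q_sets] by (simp add: q_def Compl_eq_Diff_UNIV)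
  have q: "0 \<le> q" "q \<le> 1"
    by (auto simp: q_def)
  have V1: "{0..<real k * h} \<times> (UNIV :: 'a set) \<in> sets state_space"
    and V2: "{real k * h..<real (Suc k) * h} \<times> (- B) \<in> sets state_space" for k
    using nn[of k] Bc by (auto intro!: Times_in_sets_state_space)
  have V_sets: "V k \<in> sets state_space" for k
    unfolding V_def using V1 V2 by (rule sets.Un)
  have U_sets: "U k \<in> sets state_space" for k
    unfolding U_def using nn[of k] by (auto intro!: Times_in_sets_state_space)
  have VU: "V k \<subseteq> U k" for k
    using nn[of k] by (auto simp: V_def U_def)
  have e: "emeasure immigrant_intensity ({a..<b} \<times> S) = ennreal (\<nu> * (b - a) * measure Q S)"
    if "0 \<le> a" "a \<le> b" "S \<in> sets borel" for a b S
    using that by (intro emeasure_immigrant_intensity) auto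
  have e_U: "emeasure immigrant_intensity (U k) = ennreal (\<nu> * (real (Suc k) * h))" for k
    unfolding U_def using nn[of k] nn(1)[of "Suc k"] Q.prob_space sets_eq_imp_space_eq[OF Q_sets] by (subst e) auto
  have e_V: "emeasure immigrant_intensity (V k) = ennreal (\<nu> * (real k * h) + \<nu> * h * (1 - q))" for k
  proof -
    have s: "sets immigrant_intensity = sets (state_space :: (real \<times> 'a) measure)"
      unfolding state_space_def using Q_sets
      by (intro sets_pair_measure_cong) (auto simp: sets_restrict_space)
    have "emeasure immigrant_intensity (V k) = emeasure immigrant_intensity ({0..<real k * h} \<times> UNIV)
        + emeasure immigrant_intensity ({real k * h..<real (Suc k) * h} \<times> (- B))"
      unfolding V_def using V1[of k, folded s] V2[of k, folded s] by (rule plus_emeasure[symmetric]) auto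
    also have "emeasure immigrant_intensity ({0..<real k * h} \<times> UNIV) = ennreal (\<nu> * (real k * h))"
      using nn[of k] Q.prob_space sets_eq_imp_space_eq[OF Q_sets] by (subst e) auto
    also have "emeasure immigrant_intensity ({real k * h..<real (Suc k) * h} \<times> (- B)) = ennreal (\<nu> * h * (1 - q))"
      using nn[of k] Bc by (subst e) (auto simp: qc algebra_simps)
    finally show ?thesis
      using rate_pos h q nn(1)[of k] by (simp add: ennreal_plus)
  qed
  have Z_sets: "S \<in> sets state_space \<Longrightarrow> Z S \<in> sets immigrant_algebra" for S
    unfolding Z_def by (rule no_immigrants_sets)
  have sub: "sets immigrant_algebra \<subseteq> events"
    using immigrant_subalgebra by (simp add: subalgebra_def)
  have E_sets: "E k \<in> sets immigrant_algebra" for k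
    unfolding E_def using Z_sets U_sets V_sets by blast
  have E_D: "\<omega> \<in> space M \<and> real k * h \<le> \<Gamma> 1 \<omega> \<and> \<Gamma> 1 \<omega> < real (Suc k) * h \<and> A 1 0 \<omega> \<in> B" if "\<omega> \<in> E k" for \<omega> k
  proof -
    have \<omega>: "\<omega> \<in> space M" and v: "\<forall>i\<ge>1. (\<Gamma> i \<omega>, A i 0 \<omega>) \<notin> V k"
      and "\<exists>i\<ge>1. (\<Gamma> i \<omega>, A i 0 \<omega>) \<in> U k"
      using that no_immigrants_iff[OF _ V_sets] no_immigrants_iff[OF _ U_sets]
      by (auto simp: E_def Z_def)
    then obtain i where i: "1 \<le> i" "\<Gamma> i \<omega> < real (Suc k) * h"
      by (auto simp: U_def)
    then have "\<Gamma> 1 \<omega> < real (Suc k) * h"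
      using Gamma_mono_le[OF \<omega>, of 1 i] by simp
    moreover have "(\<Gamma> 1 \<omega>, A 1 0 \<omega>) \<notin> V k"
      using v by simp
    ultimately show ?thesis
      using \<omega> Gamma_nonneg[OF _ \<omega>, of 1] by (auto simp: V_def)
  qed
  have disj: "disjoint_family E"
  proof -
    have "False" if "\<omega> \<in> E k" "\<omega> \<in> E l" "k < l" for k l \<omega>
    proof -
      have "real (Suc k) * h \<le> real l * h"
        using that h by (intro mult_right_mono) auto
      then show False
        using E_D[OF that(1)] E_D[OF that(2)] by linarith
    qed
    then show ?thesis
      unfolding disjoint_family_on_def by (metis disjoint_iff linorder_neqE_nat)
  qed
  have prob_E: "prob (E k) = exp (- (\<nu> * h)) ^ k * (exp (- (\<nu> * h * (1 - q))) - exp (- (\<nu> * h)))" for k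
  proof -
    have "Z (U k) \<subseteq> Z (V k)"
      using VU no_immigrants_iff[OF _ V_sets] no_immigrants_iff[OF _ U_sets] by (fastforce simp: Z_def)
    then have "prob (E k) = prob (Z (V k)) - prob (Z (U k))"
      unfolding E_def using Z_sets U_sets V_sets sub by (intro finite_measure_Diff) auto
    also have "prob (Z (V k)) = exp (- (\<nu> * (real k * h) + \<nu> * h * (1 - q)))"
      unfolding Z_def using rate_pos h q nn(1)[of k] by (intro prob_no_immigrants[OF V_sets e_V]) auto
    also have "prob (Z (U k)) = exp (- (\<nu> * (real (Suc k) * h)))"
      unfolding Z_def using rate_pos nn(1)[of "Suc k"] by (intro prob_no_immigrants[OF U_sets e_U]) auto
    finally show ?thesis
      by (simp add: exp_of_nat_mult[symmetric] right_diff_distrib mult_exp_exp algebra_simps)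
  qed
  have x: "0 < exp (- (\<nu> * h))" "exp (- (\<nu> * h)) < 1"
    using rate_pos h by auto
  have "(\<lambda>k. prob (E k)) sums (1 / (1 - exp (- (\<nu> * h))) * (exp (- (\<nu> * h * (1 - q))) - exp (- (\<nu> * h))))"
    unfolding prob_E using x by (intro sums_mult2 geometric_sums) auto
  moreover have "(\<lambda>k. prob (E k)) sums prob (\<Union>k. E k)"
    using E_sets sub disj by (intro finite_measure_UNION) auto
  ultimately have prob: "prob (\<Union>k. E k) = (exp (- (\<nu> * h * (1 - q))) - exp (- (\<nu> * h))) / (1 - exp (- (\<nu> * h)))"
    using sums_unique2 by fastforce
  have "exp (- (\<nu> * h)) * q * (1 - exp (- (\<nu> * h))) \<le> exp (- (\<nu> * h)) * (\<nu> * h * q)"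
  proof -
    have "1 - exp (- (\<nu> * h)) \<le> \<nu> * h"
      using exp_ge_add_one_self[of "- (\<nu> * h)"] by simp
    then have "(exp (- (\<nu> * h)) * q) * (1 - exp (- (\<nu> * h))) \<le> (exp (- (\<nu> * h)) * q) * (\<nu> * h)"
      using q by (intro mult_left_mono) auto
    then show ?thesis by (simp add: mult_ac)
  qed
  also have "\<dots> \<le> exp (- (\<nu> * h)) * (exp (\<nu> * h * q) - 1)"
  proof (rule mult_left_mono)
    show "\<nu> * h * q \<le> exp (\<nu> * h * q) - 1"
      using exp_ge_add_one_self[of "\<nu> * h * q"] by linarith
  qed simp
  also have "\<dots> = exp (- (\<nu> * h * (1 - q))) - exp (- (\<nu> * h))"
    by (simp add: right_diff_distrib mult_exp_exp algebra_simps)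
  finally have "exp (- (\<nu> * h)) * q \<le> prob (\<Union>k. E k)"
    unfolding prob using x by (simp add: pos_le_divide_eq)
  then show thesis
    using E_sets E_D by (intro that[of "\<Union>k. E k"]) (auto simp: q_def)
qed

text \<open>Letting \<open>h\<close> tend to \<open>0\<close>, the inner approximations of \<open>B\<close> and of its complement reach the probabilities
\<open>Q B\<close> and \<open>1 - Q B\<close>. These already add up to \<open>1\<close>, so both approximations are exact up to null
events. The second part is needed because a point measure forgets the labels of its points: that the
mark with label \<open>1\<close> can be recovered from it is not part of the model.\<close>

proposition first_mark:
  assumes B: "B \<in> sets borel"
  shows "prob {\<omega>\<in>space M. A 1 0 \<omega> \<in> B} = measure Q B"
    and "\<exists>E\<in>sets immigrant_algebra. AE \<omega> in M. \<omega> \<in> E \<longleftrightarrow> A 1 0 \<omega> \<in> B"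
proof -
  interpret Q: prob_space Q by (rule Q_prob)
  have sub: "sets immigrant_algebra \<subseteq> events"
    using immigrant_subalgebra by (simp add: subalgebra_def)
  have inner: "\<exists>E\<in>sets immigrant_algebra. E \<subseteq> {\<omega>\<in>space M. A 1 0 \<omega> \<in> S} \<and> measure Q S \<le> prob E"
    if S: "S \<in> sets borel" for S
  proof -
    have "\<exists>E. E \<in> sets immigrant_algebra \<and> E \<subseteq> {\<omega>\<in>space M. A 1 0 \<omega> \<in> S} \<and>
        exp (- (\<nu> * (1 / real (Suc n)))) * measure Q S \<le> prob E" for n
      by (rule first_mark_approximation[OF S, of "1 / real (Suc n)"]) auto
    then have "\<exists>E. \<forall>n. E n \<in> sets immigrant_algebra \<and> E n \<subseteq> {\<omega>\<in>space M. A 1 0 \<omega> \<in> S} \<and>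
        exp (- (\<nu> * (1 / real (Suc n)))) * measure Q S \<le> prob (E n)"
      by (intro choice allI)
    then obtain E where E: "\<And>n. E n \<in> sets immigrant_algebra" "\<And>n. E n \<subseteq> {\<omega>\<in>space M. A 1 0 \<omega> \<in> S}"
        "\<And>n. exp (- (\<nu> * (1 / real (Suc n)))) * measure Q S \<le> prob (E n)"
      by (elim exE) (auto simp del: of_nat_Suc)
    have "exp (- (\<nu> * (1 / real (Suc n)))) * measure Q S \<le> prob (\<Union>n. E n)" for n
      using E sub by (intro order_trans[OF E(3)] finite_measure_mono) auto
    moreover have "(\<lambda>n. exp (- (\<nu> * (1 / real (Suc n)))) * measure Q S) \<longlonglongrightarrow> exp (- (\<nu> * 0)) * measure Q S"
      by (intro tendsto_intros LIMSEQ_Suc lim_1_over_n)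
    ultimately have "measure Q S \<le> prob (\<Union>n. E n)"
      by (intro LIMSEQ_le_const2[where a = "prob (\<Union>n. E n)"]) auto
    then show ?thesis
      using E by (intro bexI[of _ "\<Union>n. E n"]) auto
  qed
  have A1 [measurable]: "A 1 0 \<in> borel_measurable M"
    by (rule A_measurable) simp
  have ev [measurable]: "{\<omega>\<in>space M. A 1 0 \<omega> \<in> S} \<in> events" if "S \<in> sets borel" for S
    using measurable_sets[OF A1 that] by (simp add: vimage_def Int_def conj_commute)
  have lower: "measure Q S \<le> prob {\<omega>\<in>space M. A 1 0 \<omega> \<in> S}" if S: "S \<in> sets borel" for S
    using inner[OF S] finite_measure_mono[OF _ ev[OF S]] by (meson order_trans)
  have "measure Q (- B) = 1 - measure Q B"
    using Q.prob_compl[of B] B Q_sets sets_eq_imp_space_eq[OF Q_sets] by (simp add: Compl_eq_Diff_UNIV)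
  moreover have "prob {\<omega>\<in>space M. A 1 0 \<omega> \<in> - B} = 1 - prob {\<omega>\<in>space M. A 1 0 \<omega> \<in> B}"
    using prob_neg[OF ev[OF B]] by simp
  moreover have "- B \<in> sets borel"
    using B by (simp add: Compl_eq_Diff_UNIV)
  ultimately show *: "prob {\<omega>\<in>space M. A 1 0 \<omega> \<in> B} = measure Q B"
    using lower[of B] lower[of "- B"] B by simp
  obtain E where E: "E \<in> sets immigrant_algebra" "E \<subseteq> {\<omega>\<in>space M. A 1 0 \<omega> \<in> B}" "measure Q B \<le> prob E"
    using inner[OF B] by blast
  have E_ev: "E \<in> events"
    using E sub by auto
  have "prob ({\<omega>\<in>space M. A 1 0 \<omega> \<in> B} - E) = 0"
    using E finite_measure_mono[OF E(2) ev[OF B]] * by (subst finite_measure_Diff[OF ev[OF B] E_ev]) auto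
  then have "AE \<omega> in M. \<omega> \<notin> {\<omega>\<in>space M. A 1 0 \<omega> \<in> B} - E"
    using E_ev ev[OF B] by (intro prob_eq_0[THEN iffD1]) auto
  then have "AE \<omega> in M. \<omega> \<in> E \<longleftrightarrow> A 1 0 \<omega> \<in> B"
    using AE_space by eventually_elim (use E(2) in auto)
  then show "\<exists>E\<in>sets immigrant_algebra. AE \<omega> in M. \<omega> \<in> E \<longleftrightarrow> A 1 0 \<omega> \<in> B"
    using E(1) by blast
qed

lemma first_mark_law: "distr M borel (A 1 0) = Q"
proof (rule measure_eqI)
  interpret Q: prob_space Q by (rule Q_prob)
  have A1: "A 1 0 \<in> borel_measurable M"
    by (rule A_measurable) simp
  fix S assume "S \<in> sets (distr M borel (A 1 0))"
  then have S: "S \<in> sets borel" by simp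
  then show "emeasure (distr M borel (A 1 0)) S = emeasure Q S"
    using first_mark(1)[OF S] A1
    by (simp add: emeasure_distr emeasure_eq_measure Q.emeasure_eq_measure vimage_def Int_def conj_commute)
qed (simp add: Q_sets)

text \<open>Events about the first mark agree almost surely with events about the immigrants, which makes them
admissible weights in \<open>expectation_offspring\<close>; the general \<open>h\<close> follows by simple approximation.\<close>

proposition expectation_first_cluster:
  fixes h :: "'a \<Rightarrow> complex" and g :: "(real \<times> 'a) measure \<Rightarrow> complex"
  assumes h: "h \<in> borel_measurable borel" and h_bound: "\<And>a. norm (h a) \<le> 1"
    and g: "g \<in> borel_measurable point_measure_algebra"
    and g_bound: "\<And>\<mu>. \<mu> \<in> space point_measure_algebra \<Longrightarrow> norm (g \<mu>) \<le> 1"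
  shows "expectation (\<lambda>\<omega>. h (A 1 0 \<omega>) * g (offspring_process K T A 1 \<omega>)) = (LINT a|Q. h a * (LINT \<mu>|\<kappa> a. g \<mu>))"
proof -
  have A1 [measurable]: "A 1 0 \<in> borel_measurable M"
    by (rule A_measurable) simp
  have off: "offspring_process K T A 1 \<in> M \<rightarrow>\<^sub>M point_measure_algebra"
    by (rule offspring_process_measurable) simp
  define Y where "Y \<omega> = g (offspring_process K T A 1 \<omega>)" for \<omega>
  define k where "k a = (LINT \<mu>|\<kappa> a. g \<mu>)" for a
  have Y [measurable]: "Y \<in> borel_measurable M"
    unfolding Y_def by (rule measurable_compose[OF off g])
  have Y_bound: "norm (Y \<omega>) \<le> 1" if "\<omega> \<in> space M" for \<omega>
    unfolding Y_def using measurable_space[OF off that] by (rule g_bound)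
  have k [measurable]: "k \<in> borel_measurable borel"
    unfolding k_def by (rule kernel_integral_measurable[OF g])
  have k_bound: "norm (k a) \<le> 1" for a
    unfolding k_def using g g_bound by (rule norm_kernel_integral)
  have kA [measurable]: "(\<lambda>\<omega>. k (A 1 0 \<omega>)) \<in> borel_measurable M"
    by (rule measurable_compose[OF A1 k])
  have event: "expectation (\<lambda>\<omega>. of_real (indicator S (A 1 0 \<omega>)) * Y \<omega>)
      = expectation (\<lambda>\<omega>. of_real (indicator S (A 1 0 \<omega>)) * k (A 1 0 \<omega>))" if S [measurable]: "S \<in> sets borel" for S
  proof -
    obtain E where E: "E \<in> sets immigrant_algebra" and AE_E: "AE \<omega> in M. \<omega> \<in> E \<longleftrightarrow> A 1 0 \<omega> \<in> S"
      using first_mark(2)[OF S] by blast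
    have E_M [measurable]: "E \<in> events"
      using E immigrant_subalgebra by (auto simp: subalgebra_def)
    have swap: "expectation (\<lambda>\<omega>. of_real (indicator S (A 1 0 \<omega>)) * X \<omega>) = expectation (\<lambda>\<omega>. of_real (indicator E \<omega>) * X \<omega>)"
      if [measurable]: "X \<in> borel_measurable M" for X :: "'w \<Rightarrow> complex"
    proof (rule integral_cong_AE)
      show "AE \<omega> in M. of_real (indicator S (A 1 0 \<omega>)) * X \<omega> = of_real (indicator E \<omega>) * X \<omega>"
        using AE_E by eventually_elim (simp add: indicator_def)
    qed measurable
    have W: "(\<lambda>\<omega>. of_real (indicator E \<omega>) :: complex) \<in> borel_measurable immigrant_algebra"
      using E by measurable
    have "expectation (\<lambda>\<omega>. of_real (indicator E \<omega>) * Y \<omega>) = expectation (\<lambda>\<omega>. of_real (indicator E \<omega>) * k (A 1 0 \<omega>))"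
      using expectation_offspring[OF W _ _ _ g g_bound, of "{1}"] by (simp add: Y_def k_def indicator_def)
    then show ?thesis
      unfolding swap[OF Y] swap[OF kA] .
  qed
  have simple: "expectation (\<lambda>\<omega>. s (A 1 0 \<omega>) * Y \<omega>) = expectation (\<lambda>\<omega>. s (A 1 0 \<omega>) * k (A 1 0 \<omega>))"
    if s: "simple_function borel s" for s :: "'a \<Rightarrow> complex"
  proof -
    have C: "finite (range s)"
      using s by (simp add: simple_function_def)
    have S [measurable]: "s -` {c} \<in> sets borel" for c
      using simple_functionD(2)[OF s, of "{c}"] by simp
    have expand: "expectation (\<lambda>\<omega>. s (A 1 0 \<omega>) * X \<omega>)
        = (\<Sum>c\<in>range s. c * expectation (\<lambda>\<omega>. of_real (indicator (s -` {c}) (A 1 0 \<omega>)) * X \<omega>))"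
      if [measurable]: "X \<in> borel_measurable M" and X: "\<And>\<omega>. \<omega> \<in> space M \<Longrightarrow> norm (X \<omega>) \<le> 1" for X :: "'w \<Rightarrow> complex"
    proof -
      have "s (A 1 0 \<omega>) * X \<omega> = (\<Sum>c\<in>range s. c * (of_real (indicator (s -` {c}) (A 1 0 \<omega>)) * X \<omega>))" for \<omega>
      proof -
        have "(\<Sum>c\<in>range s. c * (of_real (indicator (s -` {c}) (A 1 0 \<omega>)) * X \<omega>))
            = (\<Sum>c\<in>range s. if c = s (A 1 0 \<omega>) then c * X \<omega> else 0)"
          by (intro sum.cong) (auto simp: indicator_def)
        then show ?thesis
          using C by simp
      qed
      then have "expectation (\<lambda>\<omega>. s (A 1 0 \<omega>) * X \<omega>)
          = expectation (\<lambda>\<omega>. \<Sum>c\<in>range s. c * (of_real (indicator (s -` {c}) (A 1 0 \<omega>)) * X \<omega>))"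
        by simp
      also have "\<dots> = (\<Sum>c\<in>range s. expectation (\<lambda>\<omega>. c * (of_real (indicator (s -` {c}) (A 1 0 \<omega>)) * X \<omega>)))"
      proof (intro Bochner_Integration.integral_sum integrable_mult_right integrable_unit_disc)
        show "(\<lambda>\<omega>. of_real (indicator (s -` {c}) (A 1 0 \<omega>)) * X \<omega>) \<in> borel_measurable M" for c
          by measurable
      qed (use X in \<open>auto simp: indicator_def\<close>)
      finally show ?thesis by simp
    qed
    show ?thesis
      by (rule trans[OF expand[OF Y Y_bound] trans[OF _ expand[OF kA k_bound, symmetric]]])
        (assumption, intro sum.cong refl arg_cong2[where f = "(*)"] event S)
  qed
  obtain s where s: "\<And>n. simple_function borel (s n)" "\<And>n a. norm (s n a) \<le> 1" "\<And>a. (\<lambda>n. s n a) \<longlonglongrightarrow> h a"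
    using unit_disc_simple_approximation[OF h h_bound] by (metis UNIV_I space_borel)
  have s_meas [measurable]: "s n \<in> borel_measurable borel" for n
    using s(1) by (rule borel_measurable_simple_function)
  have lim: "(\<lambda>n. expectation (\<lambda>\<omega>. s n (A 1 0 \<omega>) * X \<omega>)) \<longlonglongrightarrow> expectation (\<lambda>\<omega>. h (A 1 0 \<omega>) * X \<omega>)"
    if [measurable]: "X \<in> borel_measurable M" and X: "\<And>\<omega>. \<omega> \<in> space M \<Longrightarrow> norm (X \<omega>) \<le> 1" for X :: "'w \<Rightarrow> complex"
  proof (rule expectation_tendsto_unit_disc)
    note [measurable] = h
    show "(\<lambda>\<omega>. s n (A 1 0 \<omega>) * X \<omega>) \<in> borel_measurable M" "(\<lambda>\<omega>. h (A 1 0 \<omega>) * X \<omega>) \<in> borel_measurable M" for n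
      by measurable
    show "(\<lambda>n. s n (A 1 0 \<omega>) * X \<omega>) \<longlonglongrightarrow> h (A 1 0 \<omega>) * X \<omega>" for \<omega>
      using s(3) by (intro tendsto_intros)
  qed (use s X in \<open>auto simp: norm_mult mult_le_one\<close>)
  have "(\<lambda>n. expectation (\<lambda>\<omega>. s n (A 1 0 \<omega>) * Y \<omega>)) \<longlonglongrightarrow> expectation (\<lambda>\<omega>. h (A 1 0 \<omega>) * Y \<omega>)"
    by (rule lim[OF Y Y_bound])
  moreover have "(\<lambda>n. expectation (\<lambda>\<omega>. s n (A 1 0 \<omega>) * Y \<omega>)) \<longlonglongrightarrow> expectation (\<lambda>\<omega>. h (A 1 0 \<omega>) * k (A 1 0 \<omega>))"
    unfolding simple[OF s(1)] by (rule lim[OF kA k_bound])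
  ultimately have "expectation (\<lambda>\<omega>. h (A 1 0 \<omega>) * Y \<omega>) = expectation (\<lambda>\<omega>. h (A 1 0 \<omega>) * k (A 1 0 \<omega>))"
    by (rule LIMSEQ_unique)
  also have "\<dots> = (LINT a|distr M borel (A 1 0). h a * k a)"
    by (intro integral_distr[symmetric] A1 borel_measurable_times h k)
  finally show ?thesis
    unfolding Y_def k_def first_mark_law .
qed

section \<open>Total claims, residue and compound sum\<close>

context
  fixes f :: "'a \<Rightarrow> real"
  assumes f [measurable]: "f \<in> borel_measurable borel" and f_nonneg: "\<And>a. 0 \<le> f a"
begin

definition compound_sum :: "real \<Rightarrow> 'w \<Rightarrow> real" where
  "compound_sum t \<omega> = (\<Sum>i=1..arrival_number t \<omega>. cluster_total f K A i \<omega>)"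

lemma cluster_total_measurable:
  assumes i: "1 \<le> i"
  shows "cluster_total f K A i \<in> borel_measurable M"
proof -
  have "(\<lambda>\<omega>. \<Sum>j=0..K i \<omega>. f (A i j \<omega>)) \<in> borel_measurable M"
    by (rule measurable_compose_countable[where f = "\<lambda>n \<omega>. \<Sum>j=0..n. f (A i j \<omega>)", OF _ K_measurable[OF i]])
      (intro borel_measurable_sum measurable_compose[OF A_measurable[OF i] f])
  then show ?thesis
    by (simp add: cluster_total_def[abs_def])
qed

lemma compound_sum_measurable [measurable]: "compound_sum t \<in> borel_measurable M"
  unfolding compound_sum_def[abs_def]
  by (rule borel_measurable_arrivals) (auto intro!: borel_measurable_sum cluster_total_measurable)

text \<open>This form and the one of \<open>residue_at_eq\<close> hold on every path, also where infinitely many claims occur, and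
thus show measurability although \<open>M\<close> may fail to be complete.\<close>

lemma total_claim_eq:
  assumes \<omega>: "\<omega> \<in> space M"
  shows "total_claim f \<Gamma> K T A t \<omega> = enn2real (\<integral>\<^sup>+p.
      (if 1 \<le> fst p \<and> snd p \<le> K (fst p) \<omega> \<and> \<Gamma> (fst p) \<omega> + T (fst p) (snd p) \<omega> \<le> t
       then ennreal (f (A (fst p) (snd p) \<omega>)) else 0) \<partial>count_space UNIV)"
proof -
  let ?S = "SIGMA i:{1..}. {0..K i \<omega>}"
  let ?x = "\<lambda>(i, j). (\<Gamma> i \<omega> + T i j \<omega>, A i j \<omega>)"
  have T0: "0 \<le> T i j \<omega>" if "1 \<le> i" "j \<le> K i \<omega>" for i j
    using that T_nonneg[OF that(1) \<omega>] T_immigrant[OF that(1) \<omega>] by (cases "j = 0") auto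
  have x: "?x \<in> ?S \<rightarrow> space state_space"
    using T0 Gamma_nonneg[OF _ \<omega>] by (auto simp: space_state_space intro!: add_nonneg_nonneg)
  have sets_cp: "sets (cluster_process \<Gamma> K T A \<omega>) = sets state_space"
    by (simp add: cluster_process_def sets_point_measure)
  have window: "{0..t} \<times> UNIV \<in> sets (state_space :: (real \<times> 'a) measure)"
    by (rule Times_in_sets_state_space) auto
  have meas: "(\<lambda>p. indicator ({0..t} \<times> UNIV) p *\<^sub>R f (snd p)) \<in> borel_measurable state_space"
    using window by (intro borel_measurable_scaleR borel_measurable_indicator snd_measurable_state_space f)
  have "total_claim f \<Gamma> K T A t \<omega> =
      enn2real (\<integral>\<^sup>+p. ennreal (indicator ({0..t} \<times> UNIV) p *\<^sub>R f (snd p)) \<partial>cluster_process \<Gamma> K T A \<omega>)"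
    unfolding total_claim_def set_lebesgue_integral_def
    using meas f_nonneg by (intro integral_eq_nn_integral) (auto cong: measurable_cong_sets[OF sets_cp refl])
  also have "(\<integral>\<^sup>+p. ennreal (indicator ({0..t} \<times> UNIV) p *\<^sub>R f (snd p)) \<partial>cluster_process \<Gamma> K T A \<omega>)
      = (\<integral>\<^sup>+p. ennreal (indicator ({0..t} \<times> UNIV) (?x p) *\<^sub>R f (snd (?x p))) \<partial>count_space ?S)"
    unfolding cluster_process_def by (rule nn_integral_point_measure[OF x measurable_compose[OF meas measurable_ennreal]])
  also have "\<dots> = (\<integral>\<^sup>+p. (if p \<in> ?S then ennreal (indicator ({0..t} \<times> UNIV) (?x p) *\<^sub>R f (snd (?x p))) else 0) \<partial>count_space UNIV)"
    by (rule nn_integral_count_space_if)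
  also have "\<dots> = (\<integral>\<^sup>+p. (if 1 \<le> fst p \<and> snd p \<le> K (fst p) \<omega> \<and> \<Gamma> (fst p) \<omega> + T (fst p) (snd p) \<omega> \<le> t
       then ennreal (f (A (fst p) (snd p) \<omega>)) else 0) \<partial>count_space UNIV)"
    using T0 Gamma_nonneg[OF _ \<omega>] by (intro nn_integral_cong) (auto simp: indicator_def split: prod.splits)
  finally show ?thesis .
qed

lemma residue_at_eq:
  "residue_at f \<Gamma> K T A t \<omega> = enn2real (\<integral>\<^sup>+p.
      (if 1 \<le> fst p \<and> 1 \<le> snd p \<and> snd p \<le> K (fst p) \<omega> \<and> 0 \<le> \<Gamma> (fst p) \<omega> \<and> \<Gamma> (fst p) \<omega> \<le> t \<and>
          t < \<Gamma> (fst p) \<omega> + T (fst p) (snd p) \<omega>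
       then ennreal (f (A (fst p) (snd p) \<omega>)) else 0) \<partial>count_space UNIV)"
proof -
  let ?S = "{(i, j). 1 \<le> i \<and> 1 \<le> j \<and> j \<le> K i \<omega> \<and> 0 \<le> \<Gamma> i \<omega> \<and> \<Gamma> i \<omega> \<le> t \<and> t < \<Gamma> i \<omega> + T i j \<omega>}"
  have "residue_at f \<Gamma> K T A t \<omega> = enn2real (\<integral>\<^sup>+p. ennreal (case p of (i, j) \<Rightarrow> f (A i j \<omega>)) \<partial>count_space ?S)"
    unfolding residue_at_def by (rule infsum_eq_enn2real_nn_integral) (auto simp: f_nonneg)
  also have "(\<integral>\<^sup>+p. ennreal (case p of (i, j) \<Rightarrow> f (A i j \<omega>)) \<partial>count_space ?S)
      = (\<integral>\<^sup>+p. (if p \<in> ?S then ennreal (case p of (i, j) \<Rightarrow> f (A i j \<omega>)) else 0) \<partial>count_space UNIV)"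
    by (rule nn_integral_count_space_if)
  finally show ?thesis
    by (simp add: split_beta cong: if_cong)
qed

lemma borel_measurable_point_sum:
  assumes "\<And>p. 1 \<le> fst p \<Longrightarrow> {\<omega>\<in>space M. P p \<omega>} \<in> sets M"
  shows "(\<lambda>\<omega>. enn2real (\<integral>\<^sup>+p. (if 1 \<le> fst p \<and> P p \<omega> then ennreal (f (A (fst p) (snd p) \<omega>)) else 0) \<partial>count_space UNIV))
    \<in> borel_measurable M"
proof (intro borel_measurable_enn2real borel_measurable_nn_integral_count_space)
  fix p :: "nat \<times> nat"
  show "(\<lambda>\<omega>. if 1 \<le> fst p \<and> P p \<omega> then ennreal (f (A (fst p) (snd p) \<omega>)) else 0) \<in> borel_measurable M"
  proof (cases "1 \<le> fst p")
    case True
    note [measurable] = A_measurable[OF True] assms[OF True]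
    show ?thesis
      using True by simp
  qed simp
qed

lemma total_claim_measurable: "total_claim f \<Gamma> K T A t \<in> borel_measurable M"
proof -
  have "(\<lambda>\<omega>. enn2real (\<integral>\<^sup>+p.
      (if 1 \<le> fst p \<and> snd p \<le> K (fst p) \<omega> \<and> \<Gamma> (fst p) \<omega> + T (fst p) (snd p) \<omega> \<le> t
       then ennreal (f (A (fst p) (snd p) \<omega>)) else 0) \<partial>count_space UNIV)) \<in> borel_measurable M"
  proof (rule borel_measurable_point_sum)
    fix p :: "nat \<times> nat" assume p: "1 \<le> fst p"
    note [measurable] = K_measurable[OF p] T_measurable[OF p] Gamma_measurable[OF p]
    show "{\<omega>\<in>space M. snd p \<le> K (fst p) \<omega> \<and> \<Gamma> (fst p) \<omega> + T (fst p) (snd p) \<omega> \<le> t} \<in> sets M"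
      by measurable
  qed
  then show ?thesis
    by (rule measurable_cong[THEN iffD1, rotated]) (simp add: total_claim_eq)
qed

lemma residue_at_measurable: "residue_at f \<Gamma> K T A t \<in> borel_measurable M"
proof -
  have "(\<lambda>\<omega>. enn2real (\<integral>\<^sup>+p.
      (if 1 \<le> fst p \<and> 1 \<le> snd p \<and> snd p \<le> K (fst p) \<omega> \<and> 0 \<le> \<Gamma> (fst p) \<omega> \<and> \<Gamma> (fst p) \<omega> \<le> t \<and>
          t < \<Gamma> (fst p) \<omega> + T (fst p) (snd p) \<omega>
       then ennreal (f (A (fst p) (snd p) \<omega>)) else 0) \<partial>count_space UNIV)) \<in> borel_measurable M"
  proof (rule borel_measurable_point_sum)
    fix p :: "nat \<times> nat" assume p: "1 \<le> fst p"
    note [measurable] = K_measurable[OF p] T_measurable[OF p] Gamma_measurable[OF p]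
    show "{\<omega>\<in>space M. 1 \<le> snd p \<and> snd p \<le> K (fst p) \<omega> \<and> 0 \<le> \<Gamma> (fst p) \<omega> \<and> \<Gamma> (fst p) \<omega> \<le> t \<and>
          t < \<Gamma> (fst p) \<omega> + T (fst p) (snd p) \<omega>} \<in> sets M"
      by measurable
  qed
  then show ?thesis
    by (simp add: residue_at_eq[abs_def])
qed

text \<open>Among the claims of clusters started by time \<open>t\<close>, those with \<open>\<Gamma> i + T i j \<le> t\<close> make up the total claim
and the others the residue; a cluster that starts later contributes to neither.\<close>

proposition AE_total_claim_decomposition:
  assumes t: "0 \<le> t"
  shows "AE \<omega> in M. total_claim f \<Gamma> K T A t \<omega> = compound_sum t \<omega> - residue_at f \<Gamma> K T A t \<omega>"
  using AE_arrivals[OF t] AE_space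
proof eventually_elim
  case (elim \<omega>)
  let ?n = "arrival_number t \<omega>"
  let ?S = "SIGMA i:{1..?n}. {0..K i \<omega>}"
  let ?F = "\<lambda>p. f (A (fst p) (snd p) \<omega>)"
  have arr: "1 \<le> i \<and> \<Gamma> i \<omega> \<le> t \<longleftrightarrow> 1 \<le> i \<and> i \<le> ?n" for i
    using elim(1) by (auto simp: set_eq_iff)
  have T0: "0 \<le> T i j \<omega>" if "1 \<le> i" "j \<le> K i \<omega>" for i j
    using that T_nonneg[OF that(1) elim(2)] T_immigrant[OF that(1) elim(2)] by (cases "j = 0") auto
  have "total_claim f \<Gamma> K T A t \<omega> = (\<Sum>p\<in>?S. if 1 \<le> fst p \<and> snd p \<le> K (fst p) \<omega> \<and>
      \<Gamma> (fst p) \<omega> + T (fst p) (snd p) \<omega> \<le> t then ?F p else 0)"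
    unfolding total_claim_eq[OF elim(2)]
  proof (rule enn2real_nn_integral_finite)
    fix p assume p: "1 \<le> fst p \<and> snd p \<le> K (fst p) \<omega> \<and> \<Gamma> (fst p) \<omega> + T (fst p) (snd p) \<omega> \<le> t"
    then have "1 \<le> fst p \<and> \<Gamma> (fst p) \<omega> \<le> t"
      using T0[of "fst p" "snd p"] by simp
    then show "p \<in> ?S"
      using p arr by (cases p) simp
  qed (simp_all add: f_nonneg)
  also have "\<dots> = (\<Sum>p\<in>?S. if \<Gamma> (fst p) \<omega> + T (fst p) (snd p) \<omega> \<le> t then ?F p else 0)"
    by (intro sum.cong) auto
  finally have total: "total_claim f \<Gamma> K T A t \<omega> = (\<Sum>p\<in>?S. if \<Gamma> (fst p) \<omega> + T (fst p) (snd p) \<omega> \<le> t then ?F p else 0)" .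
  have "residue_at f \<Gamma> K T A t \<omega> = (\<Sum>p\<in>?S. if 1 \<le> fst p \<and> 1 \<le> snd p \<and> snd p \<le> K (fst p) \<omega> \<and> 0 \<le> \<Gamma> (fst p) \<omega> \<and>
      \<Gamma> (fst p) \<omega> \<le> t \<and> t < \<Gamma> (fst p) \<omega> + T (fst p) (snd p) \<omega> then ?F p else 0)"
    unfolding residue_at_eq
  proof (rule enn2real_nn_integral_finite)
    fix p assume p: "1 \<le> fst p \<and> 1 \<le> snd p \<and> snd p \<le> K (fst p) \<omega> \<and> 0 \<le> \<Gamma> (fst p) \<omega> \<and>
      \<Gamma> (fst p) \<omega> \<le> t \<and> t < \<Gamma> (fst p) \<omega> + T (fst p) (snd p) \<omega>"
    then show "p \<in> ?S"
      using arr[of "fst p"] by (cases p) simp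
  qed (simp_all add: f_nonneg)
  also have "\<dots> = (\<Sum>p\<in>?S. if t < \<Gamma> (fst p) \<omega> + T (fst p) (snd p) \<omega> then ?F p else 0)"
  proof (rule sum.cong[OF refl])
    fix p assume p: "p \<in> ?S"
    then have i: "1 \<le> fst p" "\<Gamma> (fst p) \<omega> \<le> t"
      using arr[of "fst p"] by auto
    \<comment> \<open>The immigrant itself has delay \<open>0\<close> and never belongs to the residue.\<close>
    have "1 \<le> snd p" if "t < \<Gamma> (fst p) \<omega> + T (fst p) (snd p) \<omega>"
    proof (rule ccontr)
      assume "\<not> 1 \<le> snd p"
      then have "snd p = 0" by simp
      then show False
        using that i T_immigrant[OF i(1) elim(2)] by simp
    qed
    then show "(if 1 \<le> fst p \<and> 1 \<le> snd p \<and> snd p \<le> K (fst p) \<omega> \<and> 0 \<le> \<Gamma> (fst p) \<omega> \<and>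
        \<Gamma> (fst p) \<omega> \<le> t \<and> t < \<Gamma> (fst p) \<omega> + T (fst p) (snd p) \<omega> then ?F p else 0)
        = (if t < \<Gamma> (fst p) \<omega> + T (fst p) (snd p) \<omega> then ?F p else 0)"
      using i p Gamma_nonneg[OF i(1) elim(2)] by auto
  qed
  finally have "total_claim f \<Gamma> K T A t \<omega> + residue_at f \<Gamma> K T A t \<omega> = (\<Sum>p\<in>?S. ?F p)"
    unfolding total by (simp only: sum.distrib[symmetric]) (rule sum.cong, auto)
  also have "\<dots> = compound_sum t \<omega>"
    by (simp add: compound_sum_def cluster_total_def sum.Sigma split_beta)
  finally show ?case
    by simp
qed

section \<open>The characteristic function of the compound sum\<close>

definition claim_phase :: "real \<Rightarrow> (real \<times> 'a) measure \<Rightarrow> complex" where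
  "claim_phase u \<mu> = iexp (u * enn2real (\<integral>\<^sup>+p. ennreal (f (snd p)) \<partial>\<mu>))"

lemma claim_phase_measurable: "claim_phase u \<in> borel_measurable point_measure_algebra"
proof -
  have "(\<lambda>p. ennreal (f (snd p))) \<in> borel_measurable state_space"
    using snd_measurable_state_space[OF f] by measurable
  note [measurable] = nn_integral_measurable_point_measure_algebra[OF this]
  show ?thesis
    unfolding claim_phase_def[abs_def] by measurable
qed

lemma norm_claim_phase: "norm (claim_phase u \<mu>) \<le> 1"
  by (simp add: claim_phase_def)

text \<open>Separates the claim of the immigrant, which belongs to the conditioning, from those of its offspring.\<close>

lemma iexp_cluster_total:
  assumes i: "1 \<le> i" and \<omega>: "\<omega> \<in> space M"
  shows "iexp (u * cluster_total f K A i \<omega>) = iexp (u * f (A i 0 \<omega>)) * claim_phase u (offspring_process K T A i \<omega>)"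
proof -
  have "(\<lambda>p. ennreal (f (snd p))) \<in> borel_measurable state_space"
    using snd_measurable_state_space[OF f] by measurable
  then have "(\<integral>\<^sup>+p. ennreal (f (snd p)) \<partial>offspring_process K T A i \<omega>) = (\<Sum>j=1..K i \<omega>. ennreal (f (A i j \<omega>)))"
    unfolding offspring_process_def
    by (subst nn_integral_point_measure[OF offspring_points[OF i \<omega>]]) (auto simp: nn_integral_count_space_finite)
  also have "\<dots> = ennreal (\<Sum>j=1..K i \<omega>. f (A i j \<omega>))"
    using f_nonneg by (intro sum_ennreal) auto
  finally have "enn2real (\<integral>\<^sup>+p. ennreal (f (snd p)) \<partial>offspring_process K T A i \<omega>) = (\<Sum>j=1..K i \<omega>. f (A i j \<omega>))"
    using f_nonneg by (simp add: sum_nonneg)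
  moreover have "cluster_total f K A i \<omega> = f (A i 0 \<omega>) + (\<Sum>j=1..K i \<omega>. f (A i j \<omega>))"
    by (simp add: cluster_total_def sum.atLeast_Suc_atMost)
  ultimately show ?thesis
    by (simp add: claim_phase_def distrib_left exp_add)
qed

text \<open>The characteristic function of the cluster total given that the immigrant has mark \<open>a\<close>.\<close>

definition cluster_char :: "real \<Rightarrow> 'a \<Rightarrow> complex" where
  "cluster_char u a = iexp (u * f a) * (LINT \<mu>|\<kappa> a. claim_phase u \<mu>)"

lemma cluster_char_measurable: "cluster_char u \<in> borel_measurable borel"
  unfolding cluster_char_def[abs_def] using kernel_integral_measurable[OF claim_phase_measurable, of u] by measurable

lemma norm_cluster_char: "norm (cluster_char u a) \<le> 1"
  using norm_kernel_integral[OF claim_phase_measurable norm_claim_phase]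
  by (simp add: cluster_char_def norm_mult)

lemma char_cluster_total:
  "char (distr M borel (cluster_total f K A 1)) u = (LINT a|Q. cluster_char u a)"
proof -
  have "char (distr M borel (cluster_total f K A 1)) u = expectation (\<lambda>\<omega>. iexp (u * cluster_total f K A 1 \<omega>))"
    unfolding char_def by (rule integral_distr) (auto intro: cluster_total_measurable)
  also have "\<dots> = expectation (\<lambda>\<omega>. iexp (u * f (A 1 0 \<omega>)) * claim_phase u (offspring_process K T A 1 \<omega>))"
    by (intro Bochner_Integration.integral_cong refl iexp_cluster_total) auto
  also have "\<dots> = (LINT a|Q. iexp (u * f a) * (LINT \<mu>|\<kappa> a. claim_phase u \<mu>))"
    by (rule expectation_first_cluster[OF _ _ claim_phase_measurable norm_claim_phase]) auto
  finally show ?thesis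
    by (simp add: cluster_char_def)
qed

text \<open>On \<open>arrival_number t = n\<close> the left integrand is the phase of the claims of the \<open>n\<close> immigrants times the
product of the phases of their offspring. Averaging the latter with the kernel turns each factor
into \<open>cluster_char u\<close> at the mark of the immigrant, and summing over \<open>n\<close> leaves the generating
functional of the immigrants.\<close>

proposition char_compound_sum:
  assumes t: "0 \<le> t"
  shows "expectation (\<lambda>\<omega>. iexp (u * compound_sum t \<omega>)) =
    exp (of_real (\<nu> * t) * (char (distr M borel (cluster_total f K A 1)) u - 1))"
proof -
  let ?G = "offspring_process K T A"
  let ?\<tau> = "arrival_number t"
  define k where "k a = (LINT \<mu>|\<kappa> a. claim_phase u \<mu>)" for a
  \<comment> \<open>The single marks are not known to be functions of the point measure, but the sum of the claims of
    all immigrants up to time \<open>t\<close> is an integral against it. This makes \<open>W n\<close> an admissible weight.\<close>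
  define w where "w \<mu> = iexp (u * enn2real (\<integral>\<^sup>+p. ennreal (f (snd p)) * indicator ({0..t} \<times> UNIV) p \<partial>\<mu>))"
    for \<mu> :: "(real \<times> 'a) measure"
  define W where "W n \<omega> = (if ?\<tau> \<omega> = n then w (immigrant_process \<Gamma> A \<omega>) else 0)" for n \<omega>
  have integrand: "(\<lambda>p. ennreal (f (snd p)) * indicator ({0..t} \<times> UNIV) p) \<in> borel_measurable state_space"
    using snd_measurable_state_space[OF f] arrival_window(1)[of UNIV t] by measurable
  note [measurable] = nn_integral_measurable_point_measure_algebra[OF integrand]
  have "w \<in> borel_measurable point_measure_algebra"
    unfolding w_def[abs_def] by measurable
  then have w: "(\<lambda>\<omega>. w (immigrant_process \<Gamma> A \<omega>)) \<in> borel_measurable immigrant_algebra"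
    by (rule measurable_immigrant_algebraI)
  have W: "W n \<in> borel_measurable immigrant_algebra" for n
  proof -
    note [measurable] = w
    show ?thesis
      unfolding W_def by measurable
  qed
  have W_M [measurable]: "W n \<in> borel_measurable M" for n
    by (rule measurable_from_subalg[OF immigrant_subalgebra W])
  have W_bound: "norm (W n \<omega>) \<le> 1" for n \<omega>
    by (simp add: W_def w_def)
  have W_AE: "AE \<omega> in M. ?\<tau> \<omega> = n \<longrightarrow> W n \<omega> = (\<Prod>i=1..n. iexp (u * f (A i 0 \<omega>)))" for n
    using AE_arrivals[OF t] AE_space
  proof eventually_elim
    case (elim \<omega>)
    have "W n \<omega> = (\<Prod>i=1..n. iexp (u * f (A i 0 \<omega>)))" if n: "?\<tau> \<omega> = n"
    proof -
      have arr: "1 \<le> i \<Longrightarrow> i \<le> n \<Longrightarrow> \<Gamma> i \<omega> \<le> t" "1 \<le> i \<Longrightarrow> \<Gamma> i \<omega> \<le> t \<Longrightarrow> i \<le> n" for i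
        using elim(1) n by (auto simp: set_eq_iff)
      have "(\<integral>\<^sup>+p. ennreal (f (snd p)) * indicator ({0..t} \<times> UNIV) p \<partial>immigrant_process \<Gamma> A \<omega>)
          = (\<integral>\<^sup>+i. ennreal (f (A i 0 \<omega>)) * indicator ({0..t} \<times> UNIV) (\<Gamma> i \<omega>, A i 0 \<omega>) \<partial>count_space {1..})"
        unfolding immigrant_process_def by (subst nn_integral_point_measure[OF immigrant_points[OF elim(2)] integrand]) simp
      also have "\<dots> = (\<Sum>i=1..n. ennreal (f (A i 0 \<omega>)) * indicator ({0..t} \<times> UNIV) (\<Gamma> i \<omega>, A i 0 \<omega>))"
      proof (rule nn_integral_count_space')
        fix i assume "i \<in> {1..}" "i \<notin> {1..n}"
        then have "\<not> \<Gamma> i \<omega> \<le> t"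
          using arr(2)[of i] by auto
        then show "ennreal (f (A i 0 \<omega>)) * indicator ({0..t} \<times> UNIV) (\<Gamma> i \<omega>, A i 0 \<omega>) = 0"
          by simp
      qed auto
      also have "\<dots> = (\<Sum>i=1..n. ennreal (f (A i 0 \<omega>)))"
        using arr(1) Gamma_nonneg[OF _ elim(2)] by (intro sum.cong) auto
      also have "\<dots> = ennreal (\<Sum>i=1..n. f (A i 0 \<omega>))"
        using f_nonneg by (intro sum_ennreal) auto
      finally show ?thesis
        using n f_nonneg by (simp add: W_def w_def sum_nonneg sum_distrib_left exp_sum)
    qed
    then show ?case ..
  qed
  have G_meas: "(\<lambda>\<omega>. \<Prod>i=1..n. claim_phase u (?G i \<omega>)) \<in> borel_measurable M" for n
    by (intro borel_measurable_prod measurable_compose[OF offspring_process_measurable claim_phase_measurable]) auto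
  have k_meas: "(\<lambda>\<omega>. \<Prod>i=1..n. k (A i 0 \<omega>)) \<in> borel_measurable M" for n
    unfolding k_def
    by (intro borel_measurable_prod measurable_compose[OF A_measurable kernel_integral_measurable] claim_phase_measurable) auto
  have char_meas: "(\<lambda>\<omega>. \<Prod>i=1..n. cluster_char u (A i 0 \<omega>)) \<in> borel_measurable M" for n
    by (intro borel_measurable_prod measurable_compose[OF A_measurable cluster_char_measurable]) auto
  have prod_meas: "(\<lambda>\<omega>. \<Prod>i=1..?\<tau> \<omega>. cluster_char u (A i 0 \<omega>)) \<in> borel_measurable M"
    by (rule borel_measurable_arrivals) (rule char_meas)
  have level: "expectation (\<lambda>\<omega>. if ?\<tau> \<omega> = n then iexp (u * compound_sum t \<omega>) else 0)
      = expectation (\<lambda>\<omega>. if ?\<tau> \<omega> = n then \<Prod>i=1..?\<tau> \<omega>. cluster_char u (A i 0 \<omega>) else 0)" for n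
  proof -
    have "expectation (\<lambda>\<omega>. if ?\<tau> \<omega> = n then iexp (u * compound_sum t \<omega>) else 0)
        = expectation (\<lambda>\<omega>. W n \<omega> * (\<Prod>i=1..n. claim_phase u (?G i \<omega>)))"
    proof (rule integral_cong_AE)
      show "AE \<omega> in M. (if ?\<tau> \<omega> = n then iexp (u * compound_sum t \<omega>) else 0)
          = W n \<omega> * (\<Prod>i=1..n. claim_phase u (?G i \<omega>))"
        using W_AE[of n] AE_space
      proof eventually_elim
        case (elim \<omega>)
        show ?case
        proof (cases "?\<tau> \<omega> = n")
          case True
          have "iexp (u * compound_sum t \<omega>) = (\<Prod>i=1..n. iexp (u * cluster_total f K A i \<omega>))"
            using True by (simp add: compound_sum_def sum_distrib_left exp_sum)
          also have "\<dots> = (\<Prod>i=1..n. iexp (u * f (A i 0 \<omega>)) * claim_phase u (?G i \<omega>))"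
            using elim(2) by (intro prod.cong refl iexp_cluster_total) auto
          finally show ?thesis
            using True elim(1) by (simp add: prod.distrib)
        qed (simp add: W_def)
      qed
      show "(\<lambda>\<omega>. W n \<omega> * (\<Prod>i=1..n. claim_phase u (?G i \<omega>))) \<in> borel_measurable M"
        by (intro borel_measurable_times W_M G_meas)
    qed measurable
    also have "\<dots> = expectation (\<lambda>\<omega>. W n \<omega> * (\<Prod>i=1..n. k (A i 0 \<omega>)))"
      unfolding k_def by (rule expectation_offspring[OF W W_bound _ _ claim_phase_measurable norm_claim_phase]) auto
    also have "\<dots> = expectation (\<lambda>\<omega>. if ?\<tau> \<omega> = n then \<Prod>i=1..?\<tau> \<omega>. cluster_char u (A i 0 \<omega>) else 0)"
    proof (rule integral_cong_AE)
      show "AE \<omega> in M. W n \<omega> * (\<Prod>i=1..n. k (A i 0 \<omega>))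
          = (if ?\<tau> \<omega> = n then \<Prod>i=1..?\<tau> \<omega>. cluster_char u (A i 0 \<omega>) else 0)"
        using W_AE[of n]
      proof eventually_elim
        case (elim \<omega>)
        show ?case
        proof (cases "?\<tau> \<omega> = n")
          case True
          then show ?thesis
            using elim by (simp add: cluster_char_def k_def prod.distrib)
        qed (simp add: W_def)
      qed
      show "(\<lambda>\<omega>. W n \<omega> * (\<Prod>i=1..n. k (A i 0 \<omega>))) \<in> borel_measurable M"
        by (intro borel_measurable_times W_M k_meas)
      show "(\<lambda>\<omega>. if ?\<tau> \<omega> = n then \<Prod>i=1..?\<tau> \<omega>. cluster_char u (A i 0 \<omega>) else 0) \<in> borel_measurable M"
        using prod_meas by measurable
    qed
    finally show ?thesis .
  qed
  have "(\<lambda>n. expectation (\<lambda>\<omega>. if ?\<tau> \<omega> = n then iexp (u * compound_sum t \<omega>) else 0))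
      sums expectation (\<lambda>\<omega>. iexp (u * compound_sum t \<omega>))"
    by (rule expectation_sums_over_values) auto
  moreover have "(\<lambda>n. expectation (\<lambda>\<omega>. if ?\<tau> \<omega> = n then \<Prod>i=1..?\<tau> \<omega>. cluster_char u (A i 0 \<omega>) else 0))
      sums expectation (\<lambda>\<omega>. \<Prod>i=1..?\<tau> \<omega>. cluster_char u (A i 0 \<omega>))"
    by (rule expectation_sums_over_values[OF prod_meas])
      (auto simp: prod_norm[symmetric] intro!: prod_le_1 norm_cluster_char)
  ultimately have "expectation (\<lambda>\<omega>. iexp (u * compound_sum t \<omega>))
      = expectation (\<lambda>\<omega>. \<Prod>i=1..?\<tau> \<omega>. cluster_char u (A i 0 \<omega>))"
    unfolding level by (rule sums_unique2)
  also have "\<dots> = exp (of_real (\<nu> * t) * ((LINT a|Q. cluster_char u a) - 1))"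
    by (rule expectation_prod_marks[OF cluster_char_measurable norm_cluster_char t])
  finally show ?thesis
    unfolding char_cluster_total .
qed

end

section \<open>The central limit theorem\<close>

text \<open>The scale \<open>\<surd>(t \<nu> E D\<^sup>2)\<close> is a constant multiple of \<open>\<surd>t\<close>, so the normalised residue tends to \<open>0\<close> in
probability and the normalised total claim inherits the limit of the normalised compound sum.\<close>

proposition char_total_claim_tendsto:
  fixes f :: "'a \<Rightarrow> real"
  assumes f: "f \<in> borel_measurable borel" and f_nonneg: "\<And>a. 0 \<le> f a"
  defines "L \<equiv> distr M borel (cluster_total f K A 1)"
  assumes int2: "integrable L (\<lambda>x. x\<^sup>2)" and pos: "0 < (LINT x|L. x\<^sup>2)"
    and residue: "tendsto_in_prob (\<lambda>t \<omega>. residue_at f \<Gamma> K T A t \<omega> / sqrt t) 0 at_top"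
  shows "((\<lambda>t. char (distr M borel (\<lambda>\<omega>.
              (total_claim f \<Gamma> K T A t \<omega> - t * \<nu> * (LINT x|L. x)) / sqrt (t * \<nu> * (LINT x|L. x\<^sup>2)))) u)
           \<longlongrightarrow> of_real (exp (- u\<^sup>2 / 2))) at_top"
proof -
  have D1: "cluster_total f K A 1 \<in> borel_measurable M"
    by (rule cluster_total_measurable[OF f f_nonneg]) simp
  interpret L: real_distribution L
    unfolding L_def using D1 by (rule real_distribution_distr)
  define m where "m = (LINT x|L. x)"
  define s where "s t = sqrt (t * \<nu> * (LINT x|L. x\<^sup>2))" for t
  define Z where "Z t \<omega> = (compound_sum f t \<omega> - t * \<nu> * m) / s t" for t \<omega>
  define R where "R t \<omega> = residue_at f \<Gamma> K T A t \<omega> / s t" for t \<omega>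
  define X where "X t \<omega> = (total_claim f \<Gamma> K T A t \<omega> - t * \<nu> * m) / s t" for t \<omega>
  note [measurable] = compound_sum_measurable[OF f f_nonneg] residue_at_measurable[OF f f_nonneg]
    total_claim_measurable[OF f f_nonneg]
  have Z_meas [measurable]: "Z t \<in> borel_measurable M" and R_meas [measurable]: "R t \<in> borel_measurable M"
    and X_meas [measurable]: "X t \<in> borel_measurable M" for t
    unfolding Z_def R_def X_def by measurable
  have X_char: "char (distr M borel (X t)) u = expectation (\<lambda>\<omega>. iexp (u * (Z t \<omega> - R t \<omega>)))" if "0 \<le> t" for t
  proof -
    have "char (distr M borel (X t)) u = expectation (\<lambda>\<omega>. iexp (u * X t \<omega>))"
      unfolding char_def by (rule integral_distr) auto
    also have "\<dots> = expectation (\<lambda>\<omega>. iexp (u * (Z t \<omega> - R t \<omega>)))"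
    proof (rule integral_cong_AE)
      show "AE \<omega> in M. iexp (u * X t \<omega>) = iexp (u * (Z t \<omega> - R t \<omega>))"
        using AE_total_claim_decomposition[OF f f_nonneg that]
      proof eventually_elim
        case (elim \<omega>)
        have "X t \<omega> = Z t \<omega> - R t \<omega>"
          unfolding X_def Z_def R_def elim by (simp add: diff_divide_distrib)
        then show ?case by simp
      qed
    qed measurable
    finally show ?thesis .
  qed
  have Z_char: "expectation (\<lambda>\<omega>. iexp (u * Z t \<omega>)) =
      iexp (- (u / s t) * (t * \<nu> * m)) * exp (of_real (\<nu> * t) * (char L (u / s t) - 1))" if "0 \<le> t" for t
  proof -
    have "iexp (u * Z t \<omega>) = iexp (- (u / s t) * (t * \<nu> * m)) * iexp (u / s t * compound_sum f t \<omega>)" for \<omega>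
      unfolding exp_add[symmetric]
      by (rule arg_cong[where f = exp]) (simp add: Z_def diff_divide_distrib algebra_simps)
    then have "expectation (\<lambda>\<omega>. iexp (u * Z t \<omega>)) =
        iexp (- (u / s t) * (t * \<nu> * m)) * expectation (\<lambda>\<omega>. iexp (u / s t * compound_sum f t \<omega>))"
      by (simp only: integral_mult_right_zero)
    then show ?thesis
      unfolding char_compound_sum[OF f f_nonneg that] L_def .
  qed
  have "((\<lambda>t. iexp (- (u / s t) * (t * \<nu> * m)) * exp (of_real (\<nu> * t) * (char L (u / s t) - 1)))
      \<longlongrightarrow> of_real (exp (- u\<^sup>2 / 2))) at_top"
    unfolding s_def m_def by (rule L.compound_poisson_char_tendsto[OF int2 pos rate_pos])
  then have Z_lim: "((\<lambda>t. expectation (\<lambda>\<omega>. iexp (u * Z t \<omega>))) \<longlongrightarrow> of_real (exp (- u\<^sup>2 / 2))) at_top"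
  proof (rule Lim_transform_eventually)
    show "\<forall>\<^sub>F t in at_top. iexp (- (u / s t) * (t * \<nu> * m)) * exp (of_real (\<nu> * t) * (char L (u / s t) - 1))
        = expectation (\<lambda>\<omega>. iexp (u * Z t \<omega>))"
      using eventually_ge_at_top[of 0] by eventually_elim (rule Z_char[symmetric])
  qed
  have R_lim: "((\<lambda>t. prob {\<omega>\<in>space M. \<bar>R t \<omega>\<bar> > \<delta>}) \<longlongrightarrow> 0) at_top" if "0 < \<delta>" for \<delta>
  proof -
    let ?c = "sqrt (\<nu> * (LINT x|L. x\<^sup>2))"
    have c: "0 < ?c"
      using pos rate_pos by simp
    have "((\<lambda>t. prob {\<omega>\<in>space M. \<bar>residue_at f \<Gamma> K T A t \<omega> / sqrt t - 0\<bar> > \<delta> * ?c}) \<longlongrightarrow> 0) at_top"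
      using residue that c unfolding tendsto_in_prob_def by (auto dest: mult_pos_pos)
    then show ?thesis
    proof (rule Lim_transform_eventually)
      show "\<forall>\<^sub>F t in at_top. prob {\<omega>\<in>space M. \<bar>residue_at f \<Gamma> K T A t \<omega> / sqrt t - 0\<bar> > \<delta> * ?c}
          = prob {\<omega>\<in>space M. \<bar>R t \<omega>\<bar> > \<delta>}"
        using eventually_gt_at_top[of 0]
      proof eventually_elim
        case (elim t)
        have "R t \<omega> = residue_at f \<Gamma> K T A t \<omega> / sqrt t / ?c" for \<omega>
          by (simp add: R_def s_def real_sqrt_mult)
        then have "\<bar>R t \<omega>\<bar> > \<delta> \<longleftrightarrow> \<bar>residue_at f \<Gamma> K T A t \<omega> / sqrt t - 0\<bar> > \<delta> * ?c" for \<omega>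
          using c by (simp only: abs_divide abs_of_pos pos_less_divide_eq diff_zero)
        then show ?case by simp
      qed
    qed
  qed
  have "((\<lambda>t. expectation (\<lambda>\<omega>. iexp (u * (Z t \<omega> - R t \<omega>))) - expectation (\<lambda>\<omega>. iexp (u * Z t \<omega>))) \<longlongrightarrow> 0) at_top"
  proof (rule tendstoI)
    fix e :: real assume e: "0 < e"
    define c where "c = \<bar>u\<bar> + 1"
    define \<delta> where "\<delta> = e / 2 / c"
    have c: "0 < c" "\<bar>u\<bar> \<le> c"
      by (auto simp: c_def)
    then have \<delta>: "0 < \<delta>"
      using e by (simp add: \<delta>_def)
    have u\<delta>: "\<bar>u\<bar> * \<delta> \<le> e / 2"
      using mult_right_mono[OF c(2), of \<delta>] \<delta> c(1) by (simp add: \<delta>_def)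
    have "\<forall>\<^sub>F t in at_top. prob {\<omega>\<in>space M. \<bar>R t \<omega>\<bar> > \<delta>} < e / 4"
      using R_lim[OF \<delta>] e by (intro order_tendstoD(2)[where y = 0]) auto
    then show "\<forall>\<^sub>F t in at_top. dist (expectation (\<lambda>\<omega>. iexp (u * (Z t \<omega> - R t \<omega>)))
        - expectation (\<lambda>\<omega>. iexp (u * Z t \<omega>))) 0 < e"
    proof eventually_elim
      case (elim t)
      then show ?case
        using expectation_iexp_perturbation[OF Z_meas R_meas \<delta>, of u t t] u\<delta> by (simp only: dist_norm diff_zero)
    qed
  qed
  from tendsto_add[OF this Z_lim]
  have "((\<lambda>t. expectation (\<lambda>\<omega>. iexp (u * (Z t \<omega> - R t \<omega>)))) \<longlongrightarrow> of_real (exp (- u\<^sup>2 / 2))) at_top"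
    by simp
  then have "((\<lambda>t. char (distr M borel (X t)) u) \<longlongrightarrow> of_real (exp (- u\<^sup>2 / 2))) at_top"
  proof (rule Lim_transform_eventually)
    show "\<forall>\<^sub>F t in at_top. expectation (\<lambda>\<omega>. iexp (u * (Z t \<omega> - R t \<omega>))) = char (distr M borel (X t)) u"
      using eventually_ge_at_top[of 0] by eventually_elim (rule X_char[symmetric])
  qed
  then show ?thesis
    unfolding X_def[abs_def] m_def s_def .
qed

end

theorem proposition3p1:
  fixes M :: "'w measure" and Q :: "'a::polish_space measure" and \<nu> :: real
    and \<kappa> :: "'a \<Rightarrow> (real \<times> 'a) measure measure"
    and \<Gamma> :: "nat \<Rightarrow> 'w \<Rightarrow> real" and K :: "nat \<Rightarrow> 'w \<Rightarrow> nat"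
    and T :: "nat \<Rightarrow> nat \<Rightarrow> 'w \<Rightarrow> real" and A :: "nat \<Rightarrow> nat \<Rightarrow> 'w \<Rightarrow> 'a"
    and f :: "'a \<Rightarrow> real"
    and P :: "'d measure" and D :: "'d \<Rightarrow> real" and \<mu>\<^sub>D :: real
  assumes "marked_poisson_cluster M Q \<nu> \<kappa> \<Gamma> K T A"
    and "f \<in> borel_measurable borel" and "\<And>a. 0 \<le> f a"
    and "prob_space P" and "D \<in> borel_measurable P"
    and "distr P borel D = distr M borel (cluster_total f K A 1)"
    and "\<mu>\<^sub>D = (\<integral>x. D x \<partial>P)"
    and "integrable P (\<lambda>x. (D x)\<^sup>2)" and "0 < (\<integral>x. (D x)\<^sup>2 \<partial>P)"
    and "prob_space.tendsto_in_prob M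
           (\<lambda>t \<omega>. residue_at f \<Gamma> K T A t \<omega> / sqrt t) 0 at_top"
  shows "weak_conv_along
           (\<lambda>t. distr M borel (\<lambda>\<omega>.
              (total_claim f \<Gamma> K T A t \<omega> - t * \<nu> * \<mu>\<^sub>D) / sqrt (t * \<nu> * (\<integral>x. (D x)\<^sup>2 \<partial>P))))
           std_normal_distribution at_top"
proof -
  interpret marked_poisson_cluster M Q \<nu> \<kappa> \<Gamma> K T A by fact
  note [measurable] = \<open>D \<in> borel_measurable P\<close> total_claim_measurable[OF assms(2,3)]
  let ?L = "distr M borel (cluster_total f K A 1)"
  have m1: "(LINT x|?L. x) = \<mu>\<^sub>D"
    unfolding assms(6)[symmetric] assms(7) by (rule integral_distr) auto
  have m2: "(LINT x|?L. x\<^sup>2) = (\<integral>x. (D x)\<^sup>2 \<partial>P)"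
    unfolding assms(6)[symmetric] by (rule integral_distr) auto
  have int2: "integrable ?L (\<lambda>x. x\<^sup>2)"
    unfolding assms(6)[symmetric] using assms(8) by (subst integrable_distr_eq) auto
  show ?thesis
  proof (rule weak_conv_alongI_char)
    show "real_distribution (distr M borel (\<lambda>\<omega>.
        (total_claim f \<Gamma> K T A t \<omega> - t * \<nu> * \<mu>\<^sub>D) / sqrt (t * \<nu> * (\<integral>x. (D x)\<^sup>2 \<partial>P))))" for t
      by (rule real_distribution_distr) measurable
    show "real_distribution std_normal_distribution"
      by (rule real_dist_normal_dist)
    show "((\<lambda>t. char (distr M borel (\<lambda>\<omega>.
          (total_claim f \<Gamma> K T A t \<omega> - t * \<nu> * \<mu>\<^sub>D) / sqrt (t * \<nu> * (\<integral>x. (D x)\<^sup>2 \<partial>P)))) u)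
        \<longlongrightarrow> char std_normal_distribution u) at_top" for u
      using char_total_claim_tendsto[OF assms(2,3) int2 _ assms(10), of u] assms(9)
      by (simp only: m1 m2 char_std_normal_distribution)
  qed
qed

end
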